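(* Let $K$ be a number field, let $d = p^k$ be a prime power ($p$ prime, $k \geq 1$), and let $\mathfrak{p}$ be a prime of $\mathcal{O}_K$ above $p$ with residue degree $f$. Let $\phi = \sum_{i=0}^d a_i X^i \in K[X]$ be a monic degree-$d$ polynomial (so $a_d = 1$) with good reduction at $\mathfrak{p}$ such that $v_{\mathfrak{p}}(a_i) > 0$ whenever $i \notin \{0, d\}$. If $f \mid k$ or $a_0 \in \mathbb{Q}$, then each $x \in \mathrm{Per}_K(\phi)$ has period $m(\mathfrak{p}, f, a_0, k)$, i.e. $\phi^{m}(x) = x$ for $m = m(\mathfrak{p}, f, a_0, k)$.
   Context: For a polynomial $\phi \in K[X]$, write $\phi^n$ for the $n$-fold composition of $\phi$ with itself, and let $\mathrm{Per}_K(\phi) = \{x \in K \mid \phi^n(x) = x \text{ for some positive integer } n\}$. A point $x$ has period $n$ if $\phi^n(x) = x$ ($n$ need not be minimal). Let $v_{\mathfrak{p}}$ be the $\mathfrak{p}$-adic valuation on $K$; $\phi = \sum_{i=0}^d a_i X^i$ has good reduction at $\mathfrak{p}$ if $v_{\mathfrak{p}}(a_i) \geq 0$ for all $i$ and $v_{\mathfrak{p}}(a_d) = 0$. The residue degree is $f = [\mathcal{O}_K/\mathfrak{p} : \mathbb{F}_p]$. The quantity $m(\mathfrak{p}, f, a_0, k)$ is the smallest positive integer $m$ such that $\mathfrak{p}$ divides $a_0 m$ (i.e. $v_{\mathfrak{p}}(a_0 m) \geq 1$) and $f$ divides $k m$ in $\mathbb{Z}$. *)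

theory Defs
  imports
    "HOL-Algebra.QuotRing"
    "HOL-Algebra.Ideal_Product"
    "HOL-Algebra.Embedded_Algebras"
    "HOL-Library.Extended"
    "HOL-Computational_Algebra.Primes"
    "HOL-Computational_Algebra.Polynomial"
begin

definition number_field :: "'a::field_char_0 itself \<Rightarrow> bool" where
  "number_field _ \<longleftrightarrow>
     (\<exists>B::'a set. finite_dimensional_vector_space (\<lambda>(q::rat) x. of_rat q * x) B)"

definition ring_of_integers :: "'a::field_char_0 ring" (\<open>\<O>\<close>) where
  "\<O> = \<lparr>carrier = {x. algebraic_int x}, monoid.mult = (*), one = 1, ring.zero = 0, add = (+)\<rparr>"

definition lies_above :: "'a::field_char_0 set \<Rightarrow> nat \<Rightarrow> bool" where
  "lies_above P p \<longleftrightarrow> {n::int. of_int n \<in> P} = {n. int p dvd n}"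

text \<open>
  \<open>\<F>\<^sub>p\<close> is identified with its copy in \<open>\<O>/P\<close>, the image of \<open>\<int>\<close> under the residue map.
\<close>
definition residue_degree :: "'a::field_char_0 set \<Rightarrow> nat" where
  "residue_degree P =
     (let k = \<O> Quot P in ring.dim k ((\<lambda>n. P +>\<^bsub>\<O>\<^esub> n) ` \<int>) (carrier k))"

text \<open>
  For \<open>0 \<noteq> a \<in> \<O>\<close>, the exponent of \<open>P\<close> in the factorization of \<open>a\<O>\<close> is the largest \<open>n\<close> with
  \<open>a \<in> P\<^sup>n\<close>; the monoid \<open>ideals_set \<O>\<close> carries the product of ideals.
\<close>
definition integer_ord :: "'a::field_char_0 set \<Rightarrow> 'a \<Rightarrow> nat" where
  "integer_ord P a = (GREATEST n. a \<in> P [^]\<^bsub>ideals_set \<O>\<^esub> (n::nat))"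

definition valuation :: "'a::field_char_0 set \<Rightarrow> 'a \<Rightarrow> int extended" where
  "valuation P x =
     (if x = 0 then Pinf
      else Fin (THE n. \<exists>a b. a \<in> carrier \<O> - {0} \<and> b \<in> carrier \<O> - {0} \<and> x = a / b \<and>
                             n = int (integer_ord P a) - int (integer_ord P b)))"

definition good_reduction :: "'a::field_char_0 set \<Rightarrow> 'a poly \<Rightarrow> bool" where
  "good_reduction P \<phi> \<longleftrightarrow>
     (\<forall>i\<le>Polynomial.degree \<phi>. valuation P (Polynomial.coeff \<phi> i) \<ge> 0) \<and>
     valuation P (Polynomial.lead_coeff \<phi>) = 0"

definition Per :: "'a::field_char_0 poly \<Rightarrow> 'a set" where
  "Per \<phi> = {x. \<exists>n>0. (poly \<phi> ^^ n) x = x}"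

definition m_period :: "'a::field_char_0 set \<Rightarrow> nat \<Rightarrow> 'a \<Rightarrow> nat \<Rightarrow> nat" where
  "m_period P f a\<^sub>0 k =
     (LEAST m. m > 0 \<and> valuation P (a\<^sub>0 * of_nat m) \<ge> 1 \<and> f dvd k * m)"

end

theory Submission
  imports Defs "Jordan_Normal_Form.Char_Poly"
begin

text \<open>
  Modulo \<open>P\<close> the polynomial \<open>\<phi>\<close> is \<open>X ^ p ^ k + a\<^sub>0\<close>. If the residue of \<open>a\<^sub>0\<close> is fixed by
  \<open>X ^ p ^ k\<close>, its \<open>m\<close>-th iterate is \<open>X ^ p ^ (k * m) + m * a\<^sub>0\<close> on the residue field, which has
  \<open>p ^ f\<close> elements. So it is the identity there as soon as \<open>f\<close> divides \<open>k * m\<close> and \<open>P\<close> divides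
  \<open>m * a\<^sub>0\<close>. Both alternatives of the last hypothesis fix the residue of \<open>a\<^sub>0\<close>: the map
  \<open>X ^ p ^ k\<close> is the identity if \<open>f\<close> divides \<open>k\<close>, and it fixes the prime field, which contains the
  residues of rational numbers.

  The passage from residues to periodic points rests on two facts. Periodic points are integral at
  \<open>P\<close>, because outside the valuation ring the leading term of \<open>\<phi>\<close> dominates and orbits escape
  (\<open>Per_R\<close>). And \<open>\<phi>\<close> strictly contracts residue classes, because its derivative vanishes modulo
  \<open>P\<close>; so two congruent periodic points are equal (\<open>periodic_eq_if_cong\<close>). Since \<open>x\<close> and
  \<open>\<phi> ^ m (x)\<close> are congruent periodic points, they agree (\<open>periodic_period\<close>).

  This argument takes place in the localization of \<open>\<O>\<close> at \<open>P\<close>, and all it needs of the valuation is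
  that it detects the elements of this ring and of its maximal ideal
  (\<open>valuation_nonneg\<close>, \<open>valuation_pos\<close>, \<open>valuation_ge_1\<close>). The valuation is defined by
  powers of \<open>P\<close>, so these facts amount to the localization being a discrete valuation ring. They
  are derived from one principle: \<open>\<O>/c\<O>\<close> is finite for every positive integer \<open>c\<close>
  (\<open>finite_int_quotient\<close>), which follows from the finite degree of the field. The pigeonhole
  principle then replaces the usual chain conditions and integral bases. It shows that \<open>P\<close> is
  maximal, that it is locally generated by one element (\<open>exists_uniformizer\<close>), and that the powers of
  this element have trivial intersection (\<open>uniformizer_powers_separated\<close>).
\<close>

section \<open>Algebraic integers form a ring\<close>

text \<open>
  \<open>int_span.span S\<close> is the \<open>\<int>\<close>-submodule of the field generated by \<open>S\<close>. Algebraic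
  integers are recognised by the finitely generated submodules that they map into themselves.
\<close>
interpretation int_span: Modules.module "\<lambda>(n::int) (x::'a::field_char_0). of_int n * x"
  by unfold_locales (auto simp: algebra_simps)

text \<open>
  Multiplication by \<open>z\<close> acts on the generators through an integer matrix, and the vector of
  generators is an eigenvector of this matrix for the eigenvalue \<open>z\<close>; it is nonzero because
  \<open>1\<close> is in the span. So \<open>z\<close> is a root of the characteristic polynomial, which is monic with
  integer coefficients.
\<close>
lemma algebraic_intI_span_stable:
  fixes z :: "'a::field_char_0"
  assumes fin: "finite S" and one: "1 \<in> int_span.span S"
    and stable: "\<And>s. s \<in> S \<Longrightarrow> z * s \<in> int_span.span S"
  shows "algebraic_int z"
proof -
  obtain xs where xs: "set xs = S" "distinct xs"
    using fin finite_distinct_list by blast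
  define n where "n = length xs"
  have S_nth: "S = (\<lambda>i. xs ! i) ` {..<n}" and inj: "inj_on (\<lambda>i. xs ! i) {..<n}"
    using xs by (auto simp: n_def in_set_conv_nth inj_on_def nth_eq_iff_index_eq)
  have "\<exists>u. \<forall>s\<in>S. z * s = (\<Sum>t\<in>S. of_int (u s t) * t)"
    using stable by (subst (asm) int_span.span_finite[OF fin]) (force intro!: bchoice)
  then obtain u where u: "\<And>s. s \<in> S \<Longrightarrow> z * s = (\<Sum>t\<in>S. of_int (u s t) * t)"
    by blast
  define A :: "int mat" where "A = Matrix.mat n n (\<lambda>(i, j). u (xs ! i) (xs ! j))"
  define A' :: "'a mat" where "A' = map_mat of_int A"
  define v where "v = Matrix.vec n (\<lambda>i. xs ! i)"
  have A: "A \<in> carrier_mat n n" and A': "A' \<in> carrier_mat n n"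
    by (auto simp: A_def A'_def)
  have "A' *\<^sub>v v = z \<cdot>\<^sub>v v"
  proof (rule eq_vecI)
    fix i assume "i < dim_vec (z \<cdot>\<^sub>v v)"
    hence i: "i < n" by (simp add: v_def)
    have "(A' *\<^sub>v v) $ i = (\<Sum>j<n. of_int (u (xs ! i) (xs ! j)) * xs ! j)"
      using i by (simp add: A'_def A_def v_def scalar_prod_def atLeast0LessThan)
    also have "\<dots> = (\<Sum>t\<in>S. of_int (u (xs ! i) t) * t)"
      unfolding S_nth by (subst sum.reindex[OF inj]) simp
    also have "\<dots> = z * xs ! i"
      using u[of "xs ! i"] i S_nth by auto
    finally show "(A' *\<^sub>v v) $ i = (z \<cdot>\<^sub>v v) $ i"
      using i by (simp add: v_def)
  qed (auto simp: A'_def A_def v_def)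
  moreover have "v \<noteq> 0\<^sub>v n"
  proof
    assume v0: "v = 0\<^sub>v n"
    have "xs ! i = 0" if "i < n" for i
      using arg_cong[OF v0, of "\<lambda>w. w $ i"] that by (simp add: v_def)
    hence "S \<subseteq> {0}" using S_nth by auto
    hence "int_span.span S \<subseteq> int_span.span {0}" by (rule int_span.span_mono)
    thus False using one by (auto simp: int_span.span_singleton)
  qed
  ultimately have "eigenvalue A' z"
    unfolding eigenvalue_def eigenvector_def using A' by (auto intro!: exI[of _ v] simp: v_def)
  hence "poly (char_poly A') z = 0"
    using eigenvalue_root_char_poly[OF A'] by simp
  moreover have "char_poly A' = map_poly of_int (char_poly A)"
    unfolding A'_def by (rule of_int_hom.char_poly_hom[OF A])
  ultimately show ?thesis
    using degree_monic_char_poly[OF A] unfolding algebraic_int_altdef_ipoly by auto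
qed

lemma int_span_mult:
  fixes x y :: "'a::field_char_0"
  assumes "x \<in> int_span.span S" "y \<in> int_span.span T"
  shows "x * y \<in> int_span.span ((\<lambda>(s, t). s * t) ` (S \<times> T))"
proof -
  let ?ST = "(\<lambda>(s, t). s * t) ` (S \<times> T)"
  have st: "s * y \<in> int_span.span ?ST" if s: "s \<in> S" for s
    using assms(2)
  proof (induction rule: int_span.span_induct_alt)
    case (step c t y)
    have "s * (of_int c * t + y) = of_int c * (s * t) + s * y" by (simp add: algebra_simps)
    moreover have "s * t \<in> int_span.span ?ST"
      using step s by (intro int_span.span_base) auto
    ultimately show ?case using step by (simp add: int_span.span_add int_span.span_scale)
  qed (simp add: int_span.span_zero)
  show ?thesis using assms(1)
  proof (induction rule: int_span.span_induct_alt)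
    case (step c s x)
    have "(of_int c * s + x) * y = of_int c * (s * y) + x * y" by (simp add: algebra_simps)
    thus ?case using step st by (auto intro!: int_span.span_add int_span.span_scale)
  qed (simp add: int_span.span_zero)
qed

lemma int_span_stable:
  fixes z :: "'a::field_char_0"
  assumes "\<And>s. s \<in> S \<Longrightarrow> z * s \<in> int_span.span S" "x \<in> int_span.span S"
  shows "z * x \<in> int_span.span S"
  using assms(2)
proof (induction rule: int_span.span_induct_alt)
  case (step c s x)
  have "z * (of_int c * s + x) = of_int c * (z * s) + z * x" by (simp add: algebra_simps)
  thus ?case using step assms(1) by (auto intro!: int_span.span_add int_span.span_scale)
qed (simp add: int_span.span_zero)

text \<open>
  A monic relation of degree \<open>n\<close> rewrites \<open>x\<^sup>n\<close> through lower powers, so multiplication by \<open>x\<close>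
  does not leave their span.
\<close>
lemma powers_span_stable:
  fixes x :: "'a::field_char_0"
  assumes "x ^ n = (\<Sum>i<n. of_int (c i) * x ^ i)" "s \<in> (\<lambda>i. x ^ i) ` {..<n}"
  shows "x * s \<in> int_span.span ((\<lambda>i. x ^ i) ` {..<n})"
proof -
  obtain i where i: "i < n" "s = x ^ i" using assms(2) by auto
  show ?thesis
  proof (cases "Suc i = n")
    case True
    have "x * s = (\<Sum>i<n. of_int (c i) * x ^ i)"
      using i True assms(1) by (metis power_Suc)
    also have "\<dots> \<in> int_span.span ((\<lambda>i. x ^ i) ` {..<n})"
      by (intro int_span.span_sum int_span.span_scale int_span.span_base) auto
    finally show ?thesis .
  next
    case False
    hence "Suc i < n" using i by simp
    hence "x * s \<in> (\<lambda>i. x ^ i) ` {..<n}" using i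
      by (intro image_eqI[of _ _ "Suc i"]) auto
    thus ?thesis by (rule int_span.span_base)
  qed
qed

lemma algebraic_int_span_stable:
  fixes x :: "'a::field_char_0"
  assumes "algebraic_int x"
  obtains S where "finite S" "1 \<in> S" "\<And>s. s \<in> S \<Longrightarrow> x * s \<in> int_span.span S"
proof -
  obtain p :: "int poly" where p: "poly (map_poly of_int p) x = 0" "lead_coeff p = 1"
    using assms unfolding algebraic_int_altdef_ipoly by blast
  define n where "n = Polynomial.degree p"
  have "(\<Sum>i\<le>n. of_int (Polynomial.coeff p i) * x ^ i) = 0"
    using p(1) by (simp add: poly_altdef n_def coeff_map_poly degree_map_poly)
  hence eq: "(\<Sum>i<n. of_int (Polynomial.coeff p i) * x ^ i) + x ^ n = 0"
    using p(2) by (simp add: n_def lessThan_Suc_atMost [symmetric])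
  have "n \<noteq> 0"
    using eq by (intro notI) simp
  have xn: "x ^ n = (\<Sum>i<n. of_int (- Polynomial.coeff p i) * x ^ i)"
    using eq by (simp add: sum_negf eq_neg_iff_add_eq_0 add.commute)
  show thesis
  proof (rule that)
    show "finite ((\<lambda>i. x ^ i) ` {..<n})" by simp
    show "1 \<in> (\<lambda>i. x ^ i) ` {..<n}" using \<open>n \<noteq> 0\<close> by (intro image_eqI[of _ _ 0]) auto
    show "x * s \<in> int_span.span ((\<lambda>i. x ^ i) ` {..<n})" if "s \<in> (\<lambda>i. x ^ i) ` {..<n}" for s
      using powers_span_stable[OF xn that] .
  qed
qed

lemma algebraic_intI_monic:
  fixes x :: "'a::field_char_0"
  assumes "n > 0" "x ^ n = (\<Sum>i<n. of_int (c i) * x ^ i)"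
  shows "algebraic_int x"
proof (rule algebraic_intI_span_stable)
  show "1 \<in> int_span.span ((\<lambda>i. x ^ i) ` {..<n})"
    using assms(1) by (intro int_span.span_base image_eqI[of _ _ 0]) auto
qed (use powers_span_stable[OF assms(2)] in auto)

text \<open>
  The products of generators for \<open>x\<close> with generators for \<open>y\<close> span a module that is stable
  under both factors, hence under \<open>x + y\<close> and \<open>x * y\<close>. This is why algebraic integers form a
  ring.
\<close>
lemma common_span_stable:
  fixes x y :: "'a::field_char_0"
  assumes "algebraic_int x" "algebraic_int y"
  obtains S where "finite S" "1 \<in> int_span.span S"
    "\<And>s. s \<in> S \<Longrightarrow> x * s \<in> int_span.span S" "\<And>s. s \<in> S \<Longrightarrow> y * s \<in> int_span.span S"
proof -
  obtain S where S: "finite S" "1 \<in> S" "\<And>s. s \<in> S \<Longrightarrow> x * s \<in> int_span.span S"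
    by (rule algebraic_int_span_stable[OF assms(1)]) blast
  obtain T where T: "finite T" "1 \<in> T" "\<And>s. s \<in> T \<Longrightarrow> y * s \<in> int_span.span T"
    by (rule algebraic_int_span_stable[OF assms(2)]) blast
  let ?ST = "(\<lambda>(s, t). s * t) ` (S \<times> T)"
  show thesis
  proof (rule that)
    show "finite ?ST" using S T by auto
    show "1 \<in> int_span.span ?ST"
      using int_span_mult[of 1 S 1 T] S T by (auto intro: int_span.span_base)
  next
    fix r assume "r \<in> ?ST"
    then obtain s t where r: "s \<in> S" "t \<in> T" "r = s * t" by auto
    show "x * r \<in> int_span.span ?ST"
      using int_span_mult[OF S(3) int_span.span_base, OF r(1,2)] r(3) by (simp add: mult.assoc)
    show "y * r \<in> int_span.span ?ST"
      using int_span_mult[OF int_span.span_base T(3), OF r(1,2)] r(3)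
      by (simp add: mult.left_commute)
  qed
qed

lemma algebraic_int_add [intro]:
  fixes x y :: "'a::field_char_0"
  assumes "algebraic_int x" "algebraic_int y"
  shows "algebraic_int (x + y)"
proof -
  obtain S where S: "finite S" "1 \<in> int_span.span S"
    "\<And>s. s \<in> S \<Longrightarrow> x * s \<in> int_span.span S" "\<And>s. s \<in> S \<Longrightarrow> y * s \<in> int_span.span S"
    by (rule common_span_stable[OF assms]) blast
  show ?thesis
    by (rule algebraic_intI_span_stable[OF S(1,2)])
       (auto simp: distrib_right intro: int_span.span_add S(3,4))
qed

lemma algebraic_int_mult [intro]:
  fixes x y :: "'a::field_char_0"
  assumes "algebraic_int x" "algebraic_int y"
  shows "algebraic_int (x * y)"
proof -
  obtain S where S: "finite S" "1 \<in> int_span.span S"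
    "\<And>s. s \<in> S \<Longrightarrow> x * s \<in> int_span.span S" "\<And>s. s \<in> S \<Longrightarrow> y * s \<in> int_span.span S"
    by (rule common_span_stable[OF assms]) blast
  show ?thesis
    by (rule algebraic_intI_span_stable[OF S(1,2)])
       (auto simp: mult.assoc intro: int_span_stable[OF S(3)] S(4))
qed

lemma algebraic_int_diff [intro]:
  fixes x y :: "'a::field_char_0"
  assumes "algebraic_int x" "algebraic_int y"
  shows "algebraic_int (x - y)"
  using algebraic_int_add[OF assms(1) algebraic_int_minus[OF assms(2)]] by simp

lemma algebraic_int_of_int [simp]: "algebraic_int (of_int n :: 'a::field_char_0)"
  by (intro int_imp_algebraic_int) auto

lemma algebraic_int_of_nat [simp]: "algebraic_int (of_nat n :: 'a::field_char_0)"
  by (intro int_imp_algebraic_int) auto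

lemma algebraic_int_power [intro]:
  fixes x :: "'a::field_char_0"
  shows "algebraic_int x \<Longrightarrow> algebraic_int (x ^ n)"
  by (induction n) auto

lemma algebraic_int_sum [intro]:
  fixes f :: "'b \<Rightarrow> 'a::field_char_0"
  shows "(\<And>i. i \<in> A \<Longrightarrow> algebraic_int (f i)) \<Longrightarrow> algebraic_int (sum f A)"
  by (induction A rule: infinite_finite_induct) auto

text \<open>
  The instance of integral closedness that the pigeonhole principle calls for: two powers of \<open>x\<close>
  that are congruent modulo the algebraic integers make \<open>x\<close> a root of the polynomial
  \<open>X ^ j - X ^ i - w\<close> over them. If \<open>S\<close> spans a module that is stable under \<open>w\<close>, then the products
  of \<open>S\<close> with \<open>1, x, \<dots>, x ^ (j - 1)\<close> span one that is stable under \<open>x\<close>.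
\<close>
lemma algebraic_int_if_power_diff:
  fixes x :: "'a::field_char_0"
  assumes "i < j" "algebraic_int (x ^ j - x ^ i)"
  shows "algebraic_int x"
proof -
  define w where "w = x ^ j - x ^ i"
  obtain S where S: "finite S" "1 \<in> S" "\<And>s. s \<in> S \<Longrightarrow> w * s \<in> int_span.span S"
    using algebraic_int_span_stable[of w] assms(2) w_def by auto
  let ?X = "(\<lambda>b. x ^ b) ` {..<j}"
  let ?T = "(\<lambda>(s, t). s * t) ` (S \<times> ?X)"
  have low: "y * x ^ b \<in> int_span.span ?T" if "y \<in> int_span.span S" "b < j" for y b
    using int_span_mult[OF that(1) int_span.span_base[of "x ^ b" ?X]] that(2) by auto
  show ?thesis
  proof (rule algebraic_intI_span_stable)
    show "finite ?T" using S by auto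
    show "1 \<in> int_span.span ?T"
      using low[of 1 0] S assms(1) by (auto intro: int_span.span_base)
  next
    fix r assume "r \<in> ?T"
    then obtain s b where r: "s \<in> S" "b < j" "r = s * x ^ b" by auto
    show "x * r \<in> int_span.span ?T"
    proof (cases "Suc b = j")
      case True
      have "x * r = s * x ^ j" using r True by (auto simp: algebra_simps)
      also have "\<dots> = s * x ^ i + (w * s) * x ^ 0" by (simp add: w_def algebra_simps)
      finally show ?thesis
        using low[of s i] low[of "w * s" 0] r assms(1) S(3)
        by (auto intro!: int_span.span_add intro: int_span.span_base)
    next
      case False
      have "x * r = s * x ^ Suc b" using r by (simp add: algebra_simps)
      also have "\<dots> \<in> int_span.span ?T"
        using r False by (intro low int_span.span_base) auto
      finally show ?thesis .
    qed
  qed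
qed

section \<open>Finiteness of integers modulo a number\<close>

lemma rat_common_denominator:
  fixes u :: "nat \<Rightarrow> rat"
  shows "\<exists>D::int. D \<noteq> 0 \<and> (\<forall>i<n. of_int D * u i \<in> \<int>)"
proof (induction n)
  case (Suc n)
  then obtain D :: int where D: "D \<noteq> 0" "\<forall>i<n. of_int D * u i \<in> \<int>" by blast
  obtain a b where qu: "quotient_of (u n) = (a, b)" by (cases "quotient_of (u n)")
  have ab: "b > 0" "u n = of_int a / of_int b"
    using quotient_of_denom_pos[OF qu] quotient_of_div[OF qu] by auto
  have "of_int (D * b) * u i \<in> \<int>" if "i < Suc n" for i
  proof (cases "i = n")
    case True
    have "of_int (D * b) * u n = of_int (D * a)" using ab by simp
    thus ?thesis using True by (simp only: Ints_of_int)
  next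
    case False
    hence "of_int D * u i \<in> \<int>" using D that by auto
    hence "of_int D * u i * of_int b \<in> \<int>" by (rule Ints_mult) auto
    thus ?thesis by (simp only: of_int_mult mult_ac)
  qed
  thus ?case using D(1) ab(1) by (intro exI[of _ "D * b"]) auto
qed (auto intro: exI[of _ 1])

text \<open>
  Here \<open>n\<close> is the degree of the number field. The family \<open>x\<close> may repeat values, which linear
  dependence of the set of its values does not see; a repetition is a relation by itself.
\<close>
lemma number_field_rat_relation:
  assumes "number_field TYPE('a::field_char_0)"
  obtains n where "\<And>x :: nat \<Rightarrow> 'a.
    \<exists>u. (\<Sum>i\<le>n. of_rat (u i) * x i) = 0 \<and> (\<exists>i\<le>n. u i \<noteq> 0)"
proof -
  obtain B :: "'a set" where "finite_dimensional_vector_space (\<lambda>(q::rat) x. of_rat q * x) B"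
    using assms unfolding number_field_def by blast
  then interpret vs: finite_dimensional_vector_space "\<lambda>(q::rat) (x::'a). of_rat q * x" B .
  show thesis
  proof (rule that[of "vs.dimension"])
    fix x :: "nat \<Rightarrow> 'a"
    let ?n = "vs.dimension"
    show "\<exists>u. (\<Sum>i\<le>?n. of_rat (u i) * x i) = 0 \<and> (\<exists>i\<le>?n. u i \<noteq> 0)"
    proof (cases "inj_on x {..?n}")
      case True
      have "card (x ` {..?n}) = Suc ?n" using True by (simp add: card_image)
      moreover have "vs.dim (x ` {..?n}) \<le> ?n" by (rule vs.dim_subset_UNIV)
      ultimately have "vs.dependent (x ` {..?n})"
        by (intro vs.dependent_biggerset_general) auto
      then obtain u where u: "\<exists>v\<in>x ` {..?n}. u v \<noteq> 0"
        "(\<Sum>v\<in>x ` {..?n}. of_rat (u v) * v) = 0"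
        by (subst (asm) vs.dependent_finite) auto
      have "(\<Sum>i\<le>?n. of_rat (u (x i)) * x i) = 0"
        using u(2) by (subst (asm) sum.reindex[OF True]) (simp add: o_def)
      thus ?thesis using u(1) by (intro exI[of _ "u \<circ> x"]) auto
    next
      case False
      then obtain i j where ij: "i \<le> ?n" "j \<le> ?n" "i \<noteq> j" "x i = x j"
        unfolding inj_on_def by auto
      define u :: "nat \<Rightarrow> rat" where "u k = of_bool (k = i) - of_bool (k = j)" for k
      have "(\<Sum>k\<le>?n. of_rat (u k) * x k) =
          (\<Sum>k\<le>?n. (if k = i then x k else 0) - (if k = j then x k else 0))"
        by (intro sum.cong) (auto simp: u_def of_rat_diff)
      also have "\<dots> = 0" using ij by (simp add: sum_subtractf)
      finally show ?thesis using ij by (intro exI[of _ u]) (auto simp: u_def)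
    qed
  qed
qed

text \<open>
  Clearing denominators and dividing by the greatest common divisor gives coprime integer
  coefficients. Coprimality is the point: the relation stays nontrivial modulo every prime.
\<close>
lemma number_field_int_relation:
  assumes "number_field TYPE('a::field_char_0)"
  obtains n where "\<And>x :: nat \<Rightarrow> 'a.
    \<exists>c. (\<Sum>i\<le>n. of_int (c i) * x i) = 0 \<and> (\<forall>q. (\<forall>i\<le>n. q dvd c i) \<longrightarrow> q dvd 1)"
proof -
  obtain n where n: "\<And>x :: nat \<Rightarrow> 'a.
      \<exists>u. (\<Sum>i\<le>n. of_rat (u i) * x i) = 0 \<and> (\<exists>i\<le>n. u i \<noteq> 0)"
    using number_field_rat_relation[OF assms] by blast
  show thesis
  proof (rule that[of n])
    fix x :: "nat \<Rightarrow> 'a"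
    obtain u where u: "(\<Sum>i\<le>n. of_rat (u i) * x i) = 0" "\<exists>i\<le>n. u i \<noteq> 0"
      using n by blast
    obtain D :: int where D: "D \<noteq> 0" "\<forall>i<Suc n. of_int D * u i \<in> \<int>"
      using rat_common_denominator by blast
    define b where "b i = \<lfloor>of_int D * u i\<rfloor>" for i
    have b: "of_int (b i) = of_int D * u i" if "i \<le> n" for i
      using D(2) that by (auto simp: b_def of_int_floor_cancel)
    define g where "g = Gcd (b ` {..n})"
    obtain i where i: "i \<le> n" "u i \<noteq> 0" using u(2) by blast
    hence "b i \<noteq> 0" using b[of i] D(1) by auto
    hence g0: "g \<noteq> 0" using i(1) by (auto simp: g_def)
    define c where "c i = b i div g" for i
    have g: "b i = g * c i" if "i \<le> n" for i
      using that by (simp add: g_def c_def)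
    have "of_int g * (\<Sum>i\<le>n. of_int (c i) * x i) = (\<Sum>i\<le>n. of_rat (of_int (b i)) * x i)"
      unfolding sum_distrib_left
    proof (intro sum.cong refl)
      fix i assume "i \<in> {..n}"
      hence "of_int g * of_int (c i) = (of_int (b i) :: 'a)"
        using g[of i] by simp
      thus "of_int g * (of_int (c i) * x i) = of_rat (of_int (b i)) * x i"
        by (simp flip: mult.assoc)
    qed
    also have "\<dots> = of_int D * (\<Sum>i\<le>n. of_rat (u i) * x i)"
      unfolding sum_distrib_left
      by (intro sum.cong) (auto simp: b of_rat_mult mult_ac)
    finally have "(\<Sum>i\<le>n. of_int (c i) * x i) = 0"
      using u(1) g0 by simp
    moreover have "q dvd 1" if q: "\<forall>i\<le>n. q dvd c i" for q
    proof -
      have "g * q dvd b i" if "i \<le> n" for i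
        using q that by (simp add: g mult_dvd_mono)
      hence "g * q dvd Gcd (b ` {..n})" by (intro Gcd_greatest) auto
      hence "g * q dvd g * 1" by (simp add: g_def)
      thus ?thesis using g0 by (subst (asm) dvd_mult_cancel_left) auto
    qed
    ultimately show "\<exists>c. (\<Sum>i\<le>n. of_int (c i) * x i) = 0 \<and>
        (\<forall>q. (\<forall>i\<le>n. q dvd c i) \<longrightarrow> q dvd 1)"
      by (intro exI[of _ c]) auto
  qed
qed

text \<open>
  A relation of exact degree \<open>m\<close> between powers of \<open>x\<close>, with leading coefficient \<open>c\<close>, becomes a
  monic relation for \<open>c * x\<close> after multiplication by \<open>c ^ (m - 1)\<close>.
\<close>
lemma algebraic_int_int_multiple:
  fixes x :: "'a::field_char_0"
  assumes "number_field TYPE('a)"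
  obtains c :: int where "c \<noteq> 0" "algebraic_int (of_int c * x)"
proof -
  obtain n where n: "\<And>x :: nat \<Rightarrow> 'a.
      \<exists>c. (\<Sum>i\<le>n. of_int (c i) * x i) = 0 \<and> (\<forall>q. (\<forall>i\<le>n. q dvd c i) \<longrightarrow> q dvd 1)"
    using number_field_int_relation[OF assms] by blast
  obtain a where a: "(\<Sum>i\<le>n. of_int (a i) * x ^ i) = 0" "\<exists>i\<le>n. a i \<noteq> 0"
  proof -
    obtain a where a: "(\<Sum>i\<le>n. of_int (a i) * x ^ i) = 0" "\<And>q. (\<forall>i\<le>n. q dvd a i) \<Longrightarrow> q dvd 1"
      using n[of "\<lambda>i. x ^ i"] by auto
    show thesis using that[OF a(1)] a(2)[of 0] by auto
  qed
  define m where "m = (GREATEST i. i \<le> n \<and> a i \<noteq> 0)"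
  have m: "m \<le> n \<and> a m \<noteq> 0"
    unfolding m_def using a(2) by (rule GreatestI_ex_nat) auto
  have gt: "a i = 0" if "m < i" "i \<le> n" for i
    using Greatest_le_nat[of "\<lambda>i. i \<le> n \<and> a i \<noteq> 0" i n] that unfolding m_def by auto
  define c where "c = a m"
  have "(\<Sum>i\<le>n. of_int (a i) * x ^ i) = (\<Sum>i\<le>m. of_int (a i) * x ^ i)"
    using m gt by (intro sum.mono_neutral_right) auto
  hence eq: "(\<Sum>i<m. of_int (a i) * x ^ i) + of_int c * x ^ m = 0"
    using a(1) by (simp add: c_def lessThan_Suc_atMost [symmetric])
  have "m > 0"
  proof (rule ccontr)
    assume "\<not> m > 0"
    thus False using eq m by (simp add: c_def)
  qed
  have "(of_int c * x) ^ m = of_int c ^ (m - 1) * (of_int c * x ^ m)"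
    using \<open>m > 0\<close> by (cases m) (simp_all add: power_mult_distrib mult_ac)
  also have "of_int c * x ^ m = - (\<Sum>i<m. of_int (a i) * x ^ i)"
    using eq by (simp add: eq_neg_iff_add_eq_0 add.commute)
  also have "of_int c ^ (m - 1) * \<dots> =
      (\<Sum>i<m. of_int (- a i * c ^ (m - 1 - i)) * (of_int c * x) ^ i)"
    unfolding sum_negf[symmetric] sum_distrib_left
  proof (intro sum.cong refl)
    fix i assume "i \<in> {..<m}"
    hence "c ^ (m - 1) = c ^ (m - 1 - i) * c ^ i" by (simp flip: power_add)
    thus "of_int c ^ (m - 1) * - (of_int (a i) * x ^ i) =
        of_int (- a i * c ^ (m - 1 - i)) * (of_int c * x) ^ i"
      by (simp add: power_mult_distrib flip: of_int_power)
  qed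
  finally have "algebraic_int (of_int c * x)" by (rule algebraic_intI_monic[OF \<open>m > 0\<close>])
  thus thesis using that[of c] m by (simp add: c_def)
qed

text \<open>
  Finiteness of \<open>\<O>/c\<O>\<close>, through a finite set of representatives: for \<open>c \<noteq> 0\<close> the number
  \<open>y\<close> is in \<open>c\<O>\<close> iff \<open>y / c\<close> is an algebraic integer.
\<close>
definition finite_int_quotient :: "'a::field_char_0 itself \<Rightarrow> nat \<Rightarrow> bool" where
  "finite_int_quotient _ c \<longleftrightarrow> (\<exists>T :: 'a set. finite T \<and>
     (\<forall>x. algebraic_int x \<longrightarrow> (\<exists>t\<in>T. algebraic_int t \<and> algebraic_int ((x - t) / of_nat c))))"

text \<open>
  A family that is linearly independent modulo \<open>p\<close> has at most \<open>n\<close> members, because a relation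
  with coprime coefficients would stay nontrivial modulo \<open>p\<close>. Every algebraic integer is congruent
  modulo \<open>p\<close> to an integer combination of a longest such family, and the coefficients can be taken
  from \<open>{0..<p}\<close>.
\<close>
lemma finite_int_quotient_prime:
  assumes nf: "number_field TYPE('a::field_char_0)" and p: "Factorial_Ring.prime (p::nat)"
  shows "finite_int_quotient TYPE('a) p"
proof -
  define indep where "indep l xs \<longleftrightarrow> (\<forall>i<l. algebraic_int (xs i)) \<and>
    (\<forall>c. algebraic_int ((\<Sum>i<l. of_int (c i) * xs i) / of_nat p) \<longrightarrow> (\<forall>i<l. int p dvd c i))"
    for l :: nat and xs :: "nat \<Rightarrow> 'a"
  obtain n where n: "\<And>x :: nat \<Rightarrow> 'a.
      \<exists>c. (\<Sum>i\<le>n. of_int (c i) * x i) = 0 \<and> (\<forall>q. (\<forall>i\<le>n. q dvd c i) \<longrightarrow> q dvd 1)"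
    using number_field_int_relation[OF nf] by blast
  have bound: "l \<le> n" if indep: "indep l xs" for l xs
  proof (rule ccontr)
    assume "\<not> l \<le> n"
    obtain c where c: "(\<Sum>i\<le>n. of_int (c i) * xs i) = 0"
      "\<And>q. (\<forall>i\<le>n. q dvd c i) \<Longrightarrow> q dvd 1" using n[of xs] by auto
    define c' where "c' i = (if i \<le> n then c i else 0)" for i
    have "(\<Sum>i<l. of_int (c' i) * xs i) = (\<Sum>i\<le>n. of_int (c i) * xs i)"
      using \<open>\<not> l \<le> n\<close> by (intro sum.mono_neutral_cong_right) (auto simp: c'_def)
    hence "\<forall>i<l. int p dvd c' i" using indep c(1) unfolding indep_def by simp
    hence "int p dvd 1" using \<open>\<not> l \<le> n\<close> by (intro c(2)) (auto simp: c'_def split: if_splits)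
    thus False using p by auto
  qed
  define l where "l = (GREATEST l. \<exists>xs. indep l xs)"
  have "\<exists>xs. indep 0 xs" by (simp add: indep_def)
  hence "\<exists>xs. indep l xs"
    unfolding l_def by (rule GreatestI_nat[of "\<lambda>l. \<exists>xs. indep l xs"]) (use bound in blast)
  then obtain xs where xs: "indep l xs" by blast
  have maximal: "l' \<le> l" if "indep l' xs'" for l' xs'
    unfolding l_def by (rule Greatest_le_nat[of "\<lambda>l. \<exists>xs. indep l xs"]) (use that bound in blast)+
  define F where "F e = (\<Sum>i<l. of_int (e i) * xs i)" for e :: "nat \<Rightarrow> int"
  define T where "T = F ` ({..<l} \<rightarrow>\<^sub>E {0..<int p})"
  have "finite T" unfolding T_def by (intro finite_imageI finite_PiE) auto
  moreover have "\<exists>t\<in>T. algebraic_int t \<and> algebraic_int ((x - t) / of_nat p)"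
    if x: "algebraic_int x" for x
  proof -
    let ?xs = "xs(l := x)"
    have alg_xs: "\<And>i. i < l \<Longrightarrow> algebraic_int (xs i)" using xs by (simp add: indep_def)
    have "\<not> indep (Suc l) ?xs" using maximal[of "Suc l"] by auto
    moreover have "\<forall>i<Suc l. algebraic_int (?xs i)" using alg_xs x by (auto simp: less_Suc_eq)
    ultimately obtain c where
      "algebraic_int ((\<Sum>i<Suc l. of_int (c i) * ?xs i) / of_nat p)"
      and ndvd: "\<exists>i<Suc l. \<not> int p dvd c i" unfolding indep_def by blast
    moreover have "(\<Sum>i<Suc l. of_int (c i) * ?xs i) = F c + of_int (c l) * x"
      by (simp add: F_def)
    ultimately have w: "algebraic_int ((F c + of_int (c l) * x) / of_nat p)" by simp
    have p0: "of_nat p \<noteq> (0::'a)" using p by auto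
    \<comment> \<open>By independence of the old family the new vector must occur with a coefficient prime to \<open>p\<close>.\<close>
    have "\<not> int p dvd c l"
    proof
      assume "int p dvd c l"
      then obtain e where e: "c l = int p * e" by (elim dvdE)
      have "(F c + of_int (c l) * x) / of_nat p - of_int e * x = F c / of_nat p"
        using p0 by (simp add: e field_simps)
      moreover have "algebraic_int ((F c + of_int (c l) * x) / of_nat p - of_int e * x)"
        using w x by (intro algebraic_int_diff algebraic_int_mult) auto
      ultimately have "\<forall>i<l. int p dvd c i" using xs by (auto simp: indep_def F_def)
      thus False using ndvd \<open>int p dvd c l\<close> by (auto simp: less_Suc_eq)
    qed
    hence "coprime (c l) (int p)"
      using prime_imp_coprime[of "int p" "c l"] p by (simp add: coprime_commute)
    then obtain d e where de: "d * c l + e * int p = 1"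
      using bezout_int[of "c l" "int p"] by auto
    define h where "h = (\<lambda>i\<in>{..<l}. (- (d * c i)) mod int p)"
    define k where "k i = (- (d * c i)) div int p" for i
    have h: "h i = - (d * c i) - int p * k i" if "i < l" for i
      using that by (simp add: h_def k_def minus_mult_div_eq_mod)
    have "h \<in> {..<l} \<rightarrow>\<^sub>E {0..<int p}"
      using p by (auto simp: h_def prime_gt_0_nat)
    moreover have "algebraic_int (F h)"
      unfolding F_def using alg_xs by (intro algebraic_int_sum algebraic_int_mult) auto
    moreover have "algebraic_int ((x - F h) / of_nat p)"
    proof -
      have "F h = - of_int d * F c - of_nat p * F k"
        unfolding F_def sum_distrib_left sum_subtractf [symmetric]
        by (intro sum.cong) (auto simp: h algebra_simps)
      moreover have "of_int d * of_int (c l) + of_int e * of_nat p = (1::'a)"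
        using arg_cong[OF de, of "of_int :: int \<Rightarrow> 'a"] by simp
      hence "of_int d * of_int (c l) * x + of_int e * of_nat p * x = x"
        by (simp flip: distrib_right)
      hence "x - F h = (of_int d * of_int (c l) * x + of_int e * of_nat p * x) - F h" by simp
      ultimately have "x - F h = of_int d * (F c + of_int (c l) * x) + of_nat p * (of_int e * x + F k)"
        by (simp only:) (simp add: algebra_simps)
      hence "(x - F h) / of_nat p =
          of_int d * ((F c + of_int (c l) * x) / of_nat p) + (of_int e * x + F k)"
        using p0 by (simp only:) (simp add: field_simps)
      moreover have "algebraic_int (F k)"
        unfolding F_def using alg_xs by (intro algebraic_int_sum algebraic_int_mult) auto
      ultimately show ?thesis using w x
        by (auto intro!: algebraic_int_add algebraic_int_mult simp del: times_divide_eq_right)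
    qed
    ultimately show ?thesis unfolding T_def by blast
  qed
  ultimately show ?thesis unfolding finite_int_quotient_def by blast
qed

text \<open>
  Representatives modulo \<open>b * c\<close> are the two-digit numbers \<open>t + b * u\<close>.
\<close>
lemma finite_int_quotient_mult:
  assumes "finite_int_quotient TYPE('a::field_char_0) b" "finite_int_quotient TYPE('a) c" "b > 0"
  shows "finite_int_quotient TYPE('a) (b * c)"
proof -
  obtain T :: "'a set" where T: "finite T" "\<And>x. algebraic_int x \<Longrightarrow>
    \<exists>t\<in>T. algebraic_int t \<and> algebraic_int ((x - t) / of_nat b)"
    using assms(1) unfolding finite_int_quotient_def by blast
  obtain U :: "'a set" where U: "finite U" "\<And>x. algebraic_int x \<Longrightarrow>
    \<exists>t\<in>U. algebraic_int t \<and> algebraic_int ((x - t) / of_nat c)"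
    using assms(2) unfolding finite_int_quotient_def by blast
  show ?thesis unfolding finite_int_quotient_def
  proof (intro exI conjI allI impI)
    show "finite ((\<lambda>(t, u). t + of_nat b * u) ` (T \<times> U))" using T U by auto
    fix x :: 'a assume "algebraic_int x"
    then obtain t where t: "t \<in> T" "algebraic_int t" "algebraic_int ((x - t) / of_nat b)"
      using T(2) by blast
    then obtain u where u: "u \<in> U" "algebraic_int u"
      "algebraic_int (((x - t) / of_nat b - u) / of_nat c)" using U(2) by blast
    have "((x - t) / of_nat b - u) / of_nat c = (x - (t + of_nat b * u)) / of_nat (b * c)"
      using assms(3) by (simp add: diff_divide_distrib add_divide_distrib)
    thus "\<exists>t\<in>(\<lambda>(t, u). t + of_nat b * u) ` (T \<times> U).
        algebraic_int t \<and> algebraic_int ((x - t) / of_nat (b * c))"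
      using t u by (intro bexI[of _ "t + of_nat b * u"]) auto
  qed
qed

lemma finite_int_quotient:
  assumes nf: "number_field TYPE('a::field_char_0)" and "c > 0"
  shows "finite_int_quotient TYPE('a) c"
  using assms(2)
proof (induction c rule: less_induct)
  case (less c)
  show ?case
  proof (cases "c = 1")
    case True
    thus ?thesis unfolding finite_int_quotient_def by (auto intro!: exI[of _ "{0}"])
  next
    case False
    then obtain q where q: "Factorial_Ring.prime q" "q dvd c" using prime_factor_nat by blast
    then obtain m where m: "c = q * m" by (elim dvdE)
    have "q > 1" using q prime_gt_1_nat by blast
    hence "m < c" "m > 0" using less.prems m by auto
    hence "finite_int_quotient TYPE('a) (q * m)" using \<open>q > 1\<close>
      by (intro finite_int_quotient_mult finite_int_quotient_prime[OF nf q(1)] less.IH) auto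
    thus ?thesis using m by simp
  qed
qed

lemma nat_pigeonhole:
  fixes f :: "nat \<Rightarrow> 'b"
  assumes "finite T" "\<And>i. f i \<in> T"
  obtains i j where "i < j" "f i = f j"
proof -
  have "finite (range f)" using assms by (auto intro: finite_subset)
  hence "\<not> inj f" using finite_imageD[of f UNIV] by auto
  then obtain i j where "f i = f j" "i \<noteq> j" unfolding inj_on_def by auto
  thus thesis using that[of i j] that[of j i] by (cases i j rule: linorder_cases) auto
qed

lemma algebraic_int_pigeonhole:
  fixes x :: "nat \<Rightarrow> 'a::field_char_0"
  assumes "number_field TYPE('a)" "c > 0" "\<And>i. algebraic_int (x i)"
  obtains i j where "i < j" "algebraic_int ((x j - x i) / of_nat c)"
proof -
  obtain T :: "'a set" where T: "finite T" "\<And>x. algebraic_int x \<Longrightarrow>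
    \<exists>t\<in>T. algebraic_int t \<and> algebraic_int ((x - t) / of_nat c)"
    using finite_int_quotient[OF assms(1,2)] unfolding finite_int_quotient_def by blast
  have "\<forall>i. \<exists>t. t \<in> T \<and> algebraic_int ((x i - t) / of_nat c)"
    using T(2) assms(3) by blast
  from choice[OF this] obtain t where t: "\<And>i. t i \<in> T"
    "\<And>i. algebraic_int ((x i - t i) / of_nat c)"
    by blast
  obtain i j where ij: "i < j" "t i = t j" by (rule nat_pigeonhole[of T t, OF T(1) t(1)])
  have "(x j - t j) / of_nat c - (x i - t i) / of_nat c = (x j - x i) / of_nat c"
    using ij(2) by (simp add: diff_divide_distrib)
  hence "algebraic_int ((x j - x i) / of_nat c)"
    using algebraic_int_diff[OF t(2)[of j] t(2)[of i]] by simp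
  thus thesis by (rule that[OF ij(1)])
qed

section \<open>Prime ideals are locally principal\<close>

lemma ring_of_integers_simps [simp]:
  "carrier \<O> = {x. algebraic_int x}" "x \<otimes>\<^bsub>\<O>\<^esub> y = x * y" "\<one>\<^bsub>\<O>\<^esub> = 1"
  "\<zero>\<^bsub>\<O>\<^esub> = 0" "x \<oplus>\<^bsub>\<O>\<^esub> y = x + y"
  by (simp_all add: ring_of_integers_def)

lemma cring_ring_of_integers: "cring (\<O> :: 'a::field_char_0 ring)"
proof (intro cringI abelian_groupI comm_monoidI)
  fix x :: 'a assume "x \<in> carrier \<O>"
  thus "\<exists>y\<in>carrier \<O>. y \<oplus>\<^bsub>\<O>\<^esub> x = \<zero>\<^bsub>\<O>\<^esub>" by (intro bexI[of _ "- x"]) auto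
qed (auto simp: algebra_simps)

locale number_field_prime =
  fixes P :: "'a::field_char_0 set" and p :: nat
  assumes number_field: "number_field TYPE('a)" and prime_p: "Factorial_Ring.prime p"
    and primeideal: "primeideal P \<O>" and lies_above: "lies_above P p"
begin

sublocale P: primeideal P \<O> by (rule primeideal)

lemma P_algebraic_int: "x \<in> P \<Longrightarrow> algebraic_int x"
  using P.Icarr by simp

lemma P_add: "x \<in> P \<Longrightarrow> y \<in> P \<Longrightarrow> x + y \<in> P"
  using additive_subgroup.a_closed[OF ideal.axioms(1)[OF P.ideal_axioms], of x y] by simp

lemma P_mult: "x \<in> P \<Longrightarrow> algebraic_int a \<Longrightarrow> a * x \<in> P"
  using P.I_l_closed[of x a] by simp

lemma P_mult': "x \<in> P \<Longrightarrow> algebraic_int a \<Longrightarrow> x * a \<in> P"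
  using P_mult[of x a] by (simp add: mult.commute)

lemma P_minus: "x \<in> P \<Longrightarrow> - x \<in> P"
  using P_mult[of x "-1"] by simp

lemma P_diff: "x \<in> P \<Longrightarrow> y \<in> P \<Longrightarrow> x - y \<in> P"
  using P_add[of x "- y"] P_minus[of y] by simp

lemma P_zero: "0 \<in> P"
  using additive_subgroup.zero_closed[OF ideal.axioms(1)[OF P.ideal_axioms]] by simp

lemma P_prime: "algebraic_int a \<Longrightarrow> algebraic_int b \<Longrightarrow> a * b \<in> P \<Longrightarrow> a \<in> P \<or> b \<in> P"
  using P.I_prime[of a b] by simp

lemma of_int_in_P_iff: "of_int n \<in> P \<longleftrightarrow> int p dvd n"
  using lies_above unfolding lies_above_def by blast

lemma p_in_P: "of_nat p \<in> P"
  using of_int_in_P_iff[of "int p"] by simp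

lemma one_notin_P: "1 \<notin> P"
  using of_int_in_P_iff[of 1] prime_p by auto

lemma p_nonzero: "of_nat p \<noteq> (0::'a)"
  using prime_p by auto

lemma P_power: "algebraic_int s \<Longrightarrow> s \<notin> P \<Longrightarrow> s ^ n \<notin> P"
proof (induction n)
  case (Suc n)
  thus ?case using P_prime[of s "s ^ n"] by auto
qed (simp add: one_notin_P)

lemma mult_notin_P: "algebraic_int a \<Longrightarrow> algebraic_int b \<Longrightarrow> a \<notin> P \<Longrightarrow> b \<notin> P \<Longrightarrow> a * b \<notin> P"
  using P_prime by blast

text \<open>
  A prime ideal above \<open>p\<close> is maximal: two powers \<open>s ^ i\<close> and \<open>s ^ j\<close> agree modulo \<open>p\<close>, and
  cancelling \<open>s ^ i\<close> leaves \<open>s ^ (j - i) \<equiv> 1\<close> modulo \<open>P\<close>.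
\<close>
lemma P_inverse:
  assumes "algebraic_int s" "s \<notin> P"
  obtains t where "algebraic_int t" "s * t - 1 \<in> P"
proof -
  obtain i j where ij: "i < j" "algebraic_int ((s ^ j - s ^ i) / of_nat p)"
    using algebraic_int_pigeonhole[OF number_field, of p "\<lambda>i. s ^ i"] assms(1) prime_p
    by (auto simp: prime_gt_0_nat)
  have "s ^ i * (s ^ (j - i) - 1) = s ^ j - s ^ i"
    using ij(1) by (simp add: right_diff_distrib flip: power_add)
  also have "\<dots> = of_nat p * ((s ^ j - s ^ i) / of_nat p)"
    using p_nonzero by simp
  also have "\<dots> \<in> P" using p_in_P ij(2) by (rule P_mult')
  finally have "s ^ (j - i) - 1 \<in> P"
    using P_prime[of "s ^ i" "s ^ (j - i) - 1"] P_power[OF assms, of i] assms(1)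
    by (auto intro!: algebraic_int_diff)
  moreover have "s ^ (j - i) = s * s ^ (j - i - 1)"
    using power_minus_mult[of "j - i" s] ij(1) by (simp add: mult.commute)
  ultimately show thesis using that[of "s ^ (j - i - 1)"] assms(1) by auto
qed

text \<open>
  The number \<open>\<gamma>\<close> represents a nontrivial class of \<open>(\<O> : P)/\<O>\<close>. It has the form \<open>b / p\<close>, where
  the annihilator of \<open>b\<close> in the finite ring \<open>\<O>/p\<O>\<close> is \<open>P\<close> itself. Such a \<open>b\<close> is found by
  taking its annihilator maximal among those that are contained in \<open>P\<close>.
\<close>
lemma exists_fractional_inverse:
  obtains \<gamma> where "\<not> algebraic_int \<gamma>" "\<And>x. x \<in> P \<Longrightarrow> algebraic_int (x * \<gamma>)"
proof -
  define Ann where "Ann b = {x. algebraic_int x \<and> algebraic_int (x * b / of_nat p)}" for b :: 'a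
  have p0: "p > 0" using prime_p by (simp add: prime_gt_0_nat)
  obtain T :: "'a set" where T: "finite T" "\<And>x. algebraic_int x \<Longrightarrow>
    \<exists>t\<in>T. algebraic_int t \<and> algebraic_int ((x - t) / of_nat p)"
    using finite_int_quotient[OF number_field p0] unfolding finite_int_quotient_def by blast
  define \<A> where "\<A> = {Ann b | b. algebraic_int b \<and> Ann b \<subseteq> P}"
  \<comment> \<open>Annihilators depend only on the class of \<open>b\<close> modulo \<open>p\<close>, so there are finitely many.\<close>
  have "Ann b \<in> Ann ` T" if b: "algebraic_int b" for b
  proof -
    obtain t where t: "t \<in> T" "algebraic_int ((b - t) / of_nat p)" using T(2) b by blast
    have "algebraic_int (x * b / of_nat p) \<longleftrightarrow> algebraic_int (x * t / of_nat p)"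
      if x: "algebraic_int x" for x
    proof -
      have *: "algebraic_int (x * ((b - t) / of_nat p))" using x t(2) by blast
      have "x * b / of_nat p - x * ((b - t) / of_nat p) = x * t / of_nat p"
        "x * t / of_nat p + x * ((b - t) / of_nat p) = x * b / of_nat p"
        using p0 by (simp_all add: field_simps)
      thus ?thesis
        using algebraic_int_diff[OF _ *, of "x * b / of_nat p"]
          algebraic_int_add[OF _ *, of "x * t / of_nat p"] by metis
    qed
    hence "Ann b = Ann t" unfolding Ann_def by blast
    thus ?thesis using t(1) by blast
  qed
  hence "\<A> \<subseteq> Ann ` T" unfolding \<A>_def by blast
  hence "finite \<A>" using T(1) by (blast intro: finite_subset)
  moreover have "Ann 1 \<in> \<A>"
  proof -
    have "x \<in> P" if "algebraic_int (x / of_nat p)" for x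
      using P_mult'[OF p_in_P that] p_nonzero by simp
    hence "Ann 1 \<subseteq> P" by (auto simp: Ann_def)
    thus ?thesis unfolding \<A>_def by (intro CollectI exI[of _ 1]) auto
  qed
  ultimately obtain A where A: "A \<in> \<A>" "\<And>B. B \<in> \<A> \<Longrightarrow> A \<subseteq> B \<Longrightarrow> A = B"
    using finite_has_maximal[of \<A>] by blast
  then obtain b where b: "algebraic_int b" "A = Ann b" "Ann b \<subseteq> P" unfolding \<A>_def by blast
  have maximal: "Ann c = Ann b" if "algebraic_int c" "Ann c \<subseteq> P" "Ann b \<subseteq> Ann c" for c
    using A(2)[of "Ann c"] that b(2) unfolding \<A>_def by blast
  have Ann_mult: "Ann c \<subseteq> Ann (m * c)" if "algebraic_int m" for c m
  proof
    fix x assume "x \<in> Ann c"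
    hence "algebraic_int x" "algebraic_int (m * (x * c / of_nat p))"
      using that unfolding Ann_def by blast+
    thus "x \<in> Ann (m * c)" unfolding Ann_def by (simp add: mult_ac)
  qed
  have "m \<in> Ann b" if m: "m \<in> P" for m
  proof (rule ccontr)
    assume "m \<notin> Ann b"
    have m_alg: "algebraic_int m" using m by (rule P_algebraic_int)
    \<comment> \<open>Multiplying \<open>b\<close> by \<open>m\<close> cannot enlarge the annihilator, by maximality; so no power of \<open>m\<close> kills \<open>b\<close>.\<close>
    have Ann_power: "Ann (m ^ j * b) = Ann b" for j
    proof (induction j)
      case (Suc j)
      show ?case
      proof (rule maximal)
        show "algebraic_int (m ^ Suc j * b)" using m_alg b(1) by blast
        show "Ann b \<subseteq> Ann (m ^ Suc j * b)" using Ann_mult m_alg by blast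
        show "Ann (m ^ Suc j * b) \<subseteq> P"
        proof
          fix s assume s: "s \<in> Ann (m ^ Suc j * b)"
          show "s \<in> P"
          proof (rule ccontr)
            assume "s \<notin> P"
            have s_alg: "algebraic_int s" using s by (simp add: Ann_def)
            have "s * m \<in> Ann (m ^ j * b)"
              using s m_alg by (auto simp: Ann_def mult_ac)
            hence "m \<in> Ann (s * b)"
              unfolding Suc.IH using m_alg by (simp add: Ann_def mult_ac)
            moreover have "Ann (s * b) \<subseteq> P"
            proof
              fix x assume "x \<in> Ann (s * b)"
              hence "x * s \<in> Ann b" "algebraic_int x"
                using s_alg by (auto simp: Ann_def mult_ac)
              thus "x \<in> P" using b(3) P_prime[of x s] s_alg \<open>s \<notin> P\<close> by blast
            qed
            hence "Ann (s * b) = Ann b"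
              using maximal[of "s * b"] Ann_mult[of s b] s_alg b(1) by blast
            ultimately show False using \<open>m \<notin> Ann b\<close> by simp
          qed
        qed
      qed
    qed simp
    \<comment> \<open>But two powers of \<open>m\<close> agree modulo \<open>p\<close>, which puts \<open>m ^ (j - i) - 1\<close> into an annihilator inside \<open>P\<close>.\<close>
    obtain i j where ij: "i < j" "algebraic_int ((m ^ j - m ^ i) / of_nat p)"
      using algebraic_int_pigeonhole[OF number_field p0, of "\<lambda>i. m ^ i"] m_alg by auto
    have "(m ^ (j - i) - 1) * m ^ i = m ^ j - m ^ i"
      using ij(1) by (simp add: left_diff_distrib flip: power_add)
    hence "(m ^ (j - i) - 1) * (m ^ i * b) / of_nat p = b * ((m ^ j - m ^ i) / of_nat p)"
      by (simp flip: mult.assoc)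
    moreover have "algebraic_int (b * ((m ^ j - m ^ i) / of_nat p))"
      using b(1) ij(2) by blast
    ultimately have "algebraic_int ((m ^ (j - i) - 1) * (m ^ i * b) / of_nat p)" by (simp only:)
    moreover have "algebraic_int (m ^ (j - i) - 1)"
      using m_alg by (intro algebraic_int_diff algebraic_int_power) auto
    ultimately have "m ^ (j - i) - 1 \<in> Ann (m ^ i * b)" unfolding Ann_def by blast
    hence "m ^ (j - i) - 1 \<in> P" using Ann_power b(3) by blast
    moreover have "m ^ (j - i) \<in> P"
      using P_mult[OF m, of "m ^ (j - i - 1)"] power_minus_mult[of "j - i" m] ij(1) m_alg
      by auto
    ultimately show False using P_diff[of "m ^ (j - i)" "m ^ (j - i) - 1"] one_notin_P by simp
  qed
  hence "\<And>x. x \<in> P \<Longrightarrow> algebraic_int (x * (b / of_nat p))" by (auto simp: Ann_def)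
  moreover have "\<not> algebraic_int (b / of_nat p)"
    using b(3) one_notin_P by (auto simp: Ann_def)
  ultimately show thesis by (intro that)
qed

text \<open>
  Locally at \<open>P\<close>, the ideal \<open>P\<close> is generated by \<open>\<pi>\<close>, since \<open>s\<close> becomes invertible there. Take
  \<open>\<gamma>\<close> from above and \<open>s = \<pi> * \<gamma>\<close>, so that \<open>s * x = \<pi> * (x * \<gamma>)\<close>. Some \<open>\<pi>\<close> makes this \<open>s\<close>
  avoid \<open>P\<close>: if \<open>\<gamma>P\<close> were inside \<open>P\<close>, then all \<open>p * \<gamma> ^ n\<close> would be integral, two of them
  would agree modulo \<open>p\<close>, and \<open>\<gamma> ^ j - \<gamma> ^ i\<close> would be integral; then \<open>\<gamma>\<close> itself would be an
  algebraic integer.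
\<close>
lemma exists_uniformizer:
  obtains \<pi> s where "\<pi> \<in> P" "algebraic_int s" "s \<notin> P"
    "\<And>x. x \<in> P \<Longrightarrow> \<exists>y. algebraic_int y \<and> s * x = \<pi> * y"
proof -
  obtain \<gamma> where \<gamma>: "\<not> algebraic_int \<gamma>" "\<And>x. x \<in> P \<Longrightarrow> algebraic_int (x * \<gamma>)"
    using exists_fractional_inverse by blast
  have "\<exists>\<pi>\<in>P. \<pi> * \<gamma> \<notin> P"
  proof (rule ccontr)
    assume "\<not> (\<exists>\<pi>\<in>P. \<pi> * \<gamma> \<notin> P)"
    hence stable: "\<And>x. x \<in> P \<Longrightarrow> x * \<gamma> \<in> P" by blast
    have "of_nat p * \<gamma> ^ n \<in> P" for n
    proof (induction n)
      case (Suc n)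
      thus ?case using stable[OF Suc] by (simp add: mult_ac)
    qed (simp add: p_in_P)
    hence "algebraic_int (of_nat p * \<gamma> ^ n)" for n by (blast intro: P_algebraic_int)
    then obtain i j where ij: "i < j"
      "algebraic_int ((of_nat p * \<gamma> ^ j - of_nat p * \<gamma> ^ i) / of_nat p)"
      using algebraic_int_pigeonhole[OF number_field, of p "\<lambda>n. of_nat p * \<gamma> ^ n"] prime_p
      by (auto simp: prime_gt_0_nat)
    have "(of_nat p * \<gamma> ^ j - of_nat p * \<gamma> ^ i) / of_nat p = \<gamma> ^ j - \<gamma> ^ i"
      using p_nonzero by (simp add: diff_divide_distrib)
    thus False using algebraic_int_if_power_diff[OF ij(1), of \<gamma>] ij(2) \<gamma>(1) by simp
  qed
  then obtain \<pi> where \<pi>: "\<pi> \<in> P" "\<pi> * \<gamma> \<notin> P" by blast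
  show thesis
  proof (rule that[OF \<pi>(1) \<gamma>(2)[OF \<pi>(1)] \<pi>(2)])
    show "\<exists>y. algebraic_int y \<and> \<pi> * \<gamma> * x = \<pi> * y" if "x \<in> P" for x
      using \<gamma>(2)[OF that] by (intro exI[of _ "x * \<gamma>"]) (simp add: mult_ac)
  qed
qed

section \<open>The localization is a discrete valuation ring\<close>

text \<open>
  \<open>loc\<close> is the localization of \<open>\<O>\<close> at \<open>P\<close>, as a subring of the field, and \<open>loc_max\<close> is its
  maximal ideal.
\<close>
definition loc :: "'a set" where
  "loc = {a / s | a s. algebraic_int a \<and> algebraic_int s \<and> s \<notin> P}"

definition loc_max :: "'a set" where
  "loc_max = {a / s | a s. a \<in> P \<and> algebraic_int s \<and> s \<notin> P}"

lemma locI: "algebraic_int a \<Longrightarrow> algebraic_int s \<Longrightarrow> s \<notin> P \<Longrightarrow> a / s \<in> loc"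
  unfolding loc_def by blast

lemma locE:
  assumes "x \<in> loc"
  obtains a s where "x = a / s" "algebraic_int a" "algebraic_int s" "s \<notin> P" "s \<noteq> 0"
  using assms P_zero unfolding loc_def by blast

lemma loc_maxI: "a \<in> P \<Longrightarrow> algebraic_int s \<Longrightarrow> s \<notin> P \<Longrightarrow> a / s \<in> loc_max"
  unfolding loc_max_def by blast

lemma loc_maxE:
  assumes "x \<in> loc_max"
  obtains a s where "x = a / s" "a \<in> P" "algebraic_int s" "s \<notin> P" "s \<noteq> 0"
  using assms P_zero unfolding loc_max_def by blast

lemma loc_algebraic_int: "algebraic_int a \<Longrightarrow> a \<in> loc"
  using locI[of a 1] one_notin_P by simp

lemma loc_max_P: "a \<in> P \<Longrightarrow> a \<in> loc_max"
  using loc_maxI[of a 1] one_notin_P by simp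

lemma loc_add: assumes "x \<in> loc" "y \<in> loc" shows "x + y \<in> loc"
proof -
  obtain a s where x: "x = a / s" "algebraic_int a" "algebraic_int s" "s \<notin> P" "s \<noteq> 0"
    using assms(1) by (rule locE)
  obtain b t where y: "y = b / t" "algebraic_int b" "algebraic_int t" "t \<notin> P" "t \<noteq> 0"
    using assms(2) by (rule locE)
  have "x + y = (a * t + b * s) / (s * t)" using x y by (simp add: field_simps)
  also have "\<dots> \<in> loc" using x y by (intro locI algebraic_int_add algebraic_int_mult mult_notin_P)
  finally show ?thesis .
qed

lemma loc_mult: assumes "x \<in> loc" "y \<in> loc" shows "x * y \<in> loc"
proof -
  obtain a s where x: "x = a / s" "algebraic_int a" "algebraic_int s" "s \<notin> P" "s \<noteq> 0"
    using assms(1) by (rule locE)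
  obtain b t where y: "y = b / t" "algebraic_int b" "algebraic_int t" "t \<notin> P" "t \<noteq> 0"
    using assms(2) by (rule locE)
  have "x * y = (a * b) / (s * t)" using x y by simp
  also have "\<dots> \<in> loc" using x y by (intro locI algebraic_int_add algebraic_int_mult mult_notin_P)
  finally show ?thesis .
qed

lemma loc_max_add: assumes "x \<in> loc_max" "y \<in> loc_max" shows "x + y \<in> loc_max"
proof -
  obtain a s where x: "x = a / s" "a \<in> P" "algebraic_int s" "s \<notin> P" "s \<noteq> 0"
    using assms(1) by (rule loc_maxE)
  obtain b t where y: "y = b / t" "b \<in> P" "algebraic_int t" "t \<notin> P" "t \<noteq> 0"
    using assms(2) by (rule loc_maxE)
  have "x + y = (a * t + b * s) / (s * t)" using x y by (simp add: field_simps)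
  also have "\<dots> \<in> loc_max" using x y by (intro loc_maxI P_add P_mult' mult_notin_P algebraic_int_mult)
  finally show ?thesis .
qed

lemma loc_max_mult: assumes "x \<in> loc" "y \<in> loc_max" shows "x * y \<in> loc_max"
proof -
  obtain a s where x: "x = a / s" "algebraic_int a" "algebraic_int s" "s \<notin> P" "s \<noteq> 0"
    using assms(1) by (rule locE)
  obtain b t where y: "y = b / t" "b \<in> P" "algebraic_int t" "t \<notin> P" "t \<noteq> 0"
    using assms(2) by (rule loc_maxE)
  have "x * y = (a * b) / (s * t)" using x y by simp
  also have "\<dots> \<in> loc_max" using x y by (intro loc_maxI P_mult mult_notin_P algebraic_int_mult)
  finally show ?thesis .
qed

lemma loc_max_loc: "x \<in> loc_max \<Longrightarrow> x \<in> loc"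
  by (elim loc_maxE) (auto intro: locI P_algebraic_int)

lemma loc_minus: "x \<in> loc \<Longrightarrow> - x \<in> loc"
  using loc_mult[of "-1" x] loc_algebraic_int[of "-1"] by simp

lemma loc_diff: "x \<in> loc \<Longrightarrow> y \<in> loc \<Longrightarrow> x - y \<in> loc"
  using loc_add[of x "- y"] loc_minus by simp

lemma loc_inverse: "x \<in> loc \<Longrightarrow> x \<notin> loc_max \<Longrightarrow> inverse x \<in> loc"
proof (elim locE)
  fix a s assume x: "x = a / s" "algebraic_int a" "algebraic_int s" "s \<notin> P" "x \<notin> loc_max"
  hence "a \<notin> P" using loc_maxI by blast
  thus "inverse x \<in> loc" using x by (auto intro: locI)
qed

lemma loc_max_algebraic_int_iff: assumes "algebraic_int x" shows "x \<in> loc_max \<longleftrightarrow> x \<in> P"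
proof
  assume "x \<in> loc_max"
  then obtain a s where x: "x = a / s" "a \<in> P" "algebraic_int s" "s \<notin> P" "s \<noteq> 0"
    by (rule loc_maxE)
  hence "x * s \<in> P" by simp
  thus "x \<in> P" using P_prime assms x by blast
qed (rule loc_max_P)

lemma one_notin_loc_max: "1 \<notin> loc_max"
  using loc_max_algebraic_int_iff[of 1] one_notin_P by simp

text \<open>
  The residue field of \<open>loc\<close> is that of \<open>\<O>\<close>: denominators are invertible modulo \<open>P\<close>.
\<close>
lemma loc_residue:
  assumes "x \<in> loc" obtains y where "algebraic_int y" "x - y \<in> loc_max"
proof -
  obtain a s where x: "x = a / s" "algebraic_int a" "algebraic_int s" "s \<notin> P" "s \<noteq> 0"
    using assms by (rule locE)
  obtain t where t: "algebraic_int t" "s * t - 1 \<in> P" using P_inverse x by blast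
  have "x - a * t = (- a) * (s * t - 1) / s" using x(1,5) by (simp add: field_simps)
  also have "\<dots> \<in> loc_max" using x t by (intro loc_maxI P_mult) auto
  finally show thesis using that[of "a * t"] x t by blast
qed

lemma fraction_of_algebraic_ints:
  fixes x :: 'a
  obtains a b where "algebraic_int a" "algebraic_int b" "b \<noteq> 0" "x = a / b"
proof -
  obtain c :: int where c: "c \<noteq> 0" "algebraic_int (of_int c * x)"
    using algebraic_int_int_multiple[OF number_field, of x] by blast
  thus thesis by (intro that[of "of_int c * x" "of_int c"]) auto
qed

text \<open>
  Every nonzero ideal of \<open>\<O>\<close> contains a positive integer \<open>c\<close>; so it is determined by finitely
  many residues modulo \<open>c\<close>.
\<close>
lemma algebraic_int_divides_nat:
  fixes a :: 'a
  assumes "algebraic_int a" "a \<noteq> 0"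
  obtains b c where "algebraic_int b" "a * b = of_nat c" "c > 0"
proof -
  obtain c :: int where c: "c \<noteq> 0" "algebraic_int (of_int c * inverse a)"
    using algebraic_int_int_multiple[OF number_field, of "inverse a"] by blast
  have "algebraic_int (of_nat (nat \<bar>c\<bar>) * inverse a)"
  proof (cases "c \<ge> 0")
    case False
    hence "of_nat (nat \<bar>c\<bar>) * inverse a = - (of_int c * inverse a)" by simp
    thus ?thesis using c(2) by (simp only: algebraic_int_minus_iff)
  qed (use c(2) in simp)
  moreover have "a * (of_nat (nat \<bar>c\<bar>) * inverse a) = of_nat (nat \<bar>c\<bar>)" using assms(2) by simp
  ultimately show thesis using that[of _ "nat \<bar>c\<bar>"] c(1) by simp
qed

end

text \<open>
  The valuation is computed by means of a uniformizer \<open>\<pi>\<close>, but does not depend on it. The locale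
  fixes one; its results that do not mention \<open>\<pi>\<close> are exported at the end of this part.
\<close>
locale number_field_prime_uniformizer = number_field_prime P p
  for P :: "'a::field_char_0 set" and p +
  fixes \<pi> s\<^sub>0 :: 'a
  assumes uniformizer: "\<pi> \<in> P" "algebraic_int s\<^sub>0" "s\<^sub>0 \<notin> P"
    "\<And>x. x \<in> P \<Longrightarrow> \<exists>y. algebraic_int y \<and> s\<^sub>0 * x = \<pi> * y"
begin

lemma uniformizer_nonzero: "\<pi> \<noteq> 0"
proof
  assume "\<pi> = 0"
  hence "s\<^sub>0 * of_nat p = 0" using uniformizer(4)[OF p_in_P] by simp
  thus False using p_nonzero uniformizer(3) P_zero by auto
qed

lemma loc_max_div_uniformizer: assumes "x \<in> loc_max" shows "x / \<pi> \<in> loc"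
proof -
  obtain a s where x: "x = a / s" "a \<in> P" "algebraic_int s" "s \<notin> P" "s \<noteq> 0"
    using assms by (rule loc_maxE)
  obtain y where y: "algebraic_int y" "s\<^sub>0 * a = \<pi> * y" using uniformizer(4) x by blast
  have "s\<^sub>0 \<noteq> 0" using uniformizer(3) P_zero by auto
  hence "x / \<pi> = y / (s\<^sub>0 * s)"
    using x(1,5) y(2) uniformizer_nonzero by (simp add: field_simps)
  thus ?thesis using y(1) x(3,4) uniformizer(2,3) mult_notin_P
    by (auto intro!: locI)
qed

lemma uniformizer_power_loc: "\<pi> ^ n \<in> loc"
  using P_algebraic_int[OF uniformizer(1)] by (intro loc_algebraic_int algebraic_int_power)

lemma mult_uniformizer: assumes "x \<in> loc" "n > 0" shows "x * \<pi> ^ n \<in> loc_max"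
proof -
  have "\<pi> ^ n = \<pi> ^ (n - 1) * \<pi>" using power_minus_mult[OF assms(2), of \<pi>] by simp
  moreover have "x * \<pi> ^ (n - 1) \<in> loc"
    using assms(1) by (intro loc_mult uniformizer_power_loc)
  ultimately show ?thesis
    using loc_max_mult[of "x * \<pi> ^ (n - 1)" \<pi>] loc_max_P[OF uniformizer(1)] by (simp add: mult_ac)
qed

text \<open>
  Krull's intersection theorem for \<open>loc\<close>. If all \<open>\<pi> ^ n\<close> divided \<open>a\<close>, consider the ideals
  \<open>J n\<close> of those \<open>y\<close> for which \<open>a\<close> divides \<open>y * \<pi> ^ n\<close> in \<open>loc\<close>. They contain \<open>a\<O>\<close>, so
  only finitely many different ones occur, and \<open>J n = J m\<close> for some \<open>n < m\<close>. Writing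
  \<open>a / \<pi> ^ m = y / s\<close>, the number \<open>y\<close> is in \<open>J m\<close>, hence in \<open>J n\<close>, and this
  makes \<open>s\<close> divisible by \<open>\<pi> ^ (m - n)\<close>.
\<close>
lemma uniformizer_powers_separated:
  assumes "algebraic_int a" "a \<noteq> 0"
  shows "\<exists>n. a / \<pi> ^ n \<notin> loc"
proof (rule ccontr)
  assume "\<nexists>n. a / \<pi> ^ n \<notin> loc"
  hence all: "\<And>n. a / \<pi> ^ n \<in> loc" by blast
  obtain b c where bc: "algebraic_int b" "a * b = of_nat c" "c > 0"
    using algebraic_int_divides_nat[OF assms] by blast
  obtain T :: "'a set" where T: "finite T" "\<And>x. algebraic_int x \<Longrightarrow>
    \<exists>t\<in>T. algebraic_int t \<and> algebraic_int ((x - t) / of_nat c)"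
    using finite_int_quotient[OF number_field bc(3)] unfolding finite_int_quotient_def by blast
  define J where "J n = {y. algebraic_int y \<and> y * \<pi> ^ n / a \<in> loc}" for n
  have J_cong: "y * \<pi> ^ n / a - t * \<pi> ^ n / a \<in> loc"
    if "algebraic_int ((y - t) / of_nat c)" for y t n
  proof -
    have "of_nat c \<noteq> (0::'a)" using bc(3) by simp
    hence "y * \<pi> ^ n / a - t * \<pi> ^ n / a = (y - t) / of_nat c * (a * b) * \<pi> ^ n / a"
      unfolding bc(2) by (simp add: left_diff_distrib diff_divide_distrib)
    also have "\<dots> = (y - t) / of_nat c * b * \<pi> ^ n" using assms(2) by simp
    also have "\<dots> \<in> loc"
      using that bc(1) P_algebraic_int[OF uniformizer(1)]
      by (intro loc_algebraic_int algebraic_int_mult algebraic_int_power)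
    finally show ?thesis .
  qed
  obtain n m where nm: "n < m" "J n \<inter> T = J m \<inter> T"
    by (rule nat_pigeonhole[of "Pow T" "\<lambda>n. J n \<inter> T"]) (use T(1) in auto)
  obtain y s where y: "a / \<pi> ^ m = y / s" "algebraic_int y" "algebraic_int s" "s \<notin> P" "s \<noteq> 0"
    using all[of m] by (rule locE)
  have sy: "y * \<pi> ^ m / a = s"
    using y(1,5) assms(2) uniformizer_nonzero by (simp add: field_simps)
  obtain t where t: "t \<in> T" "algebraic_int t" "algebraic_int ((y - t) / of_nat c)"
    using T(2) y(2) by blast
  have "t * \<pi> ^ m / a \<in> loc"
    using loc_diff[OF _ J_cong[OF t(3), of m], of "y * \<pi> ^ m / a"] sy y(3)
    by (simp add: loc_algebraic_int)
  hence "t \<in> J m \<inter> T" using t(1,2) by (simp add: J_def)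
  hence "t \<in> J n" using nm(2) by blast
  hence "t * \<pi> ^ n / a \<in> loc" by (simp add: J_def)
  hence "y * \<pi> ^ n / a \<in> loc"
    using loc_add[OF _ J_cong[OF t(3), of n], of "t * \<pi> ^ n / a"] by simp
  hence "y * \<pi> ^ n / a * \<pi> ^ (m - n) \<in> loc_max" using nm(1) by (intro mult_uniformizer) auto
  moreover have "y * \<pi> ^ n / a * \<pi> ^ (m - n) = y * \<pi> ^ m / a"
    using nm(1) by (simp flip: power_add)
  ultimately have "s \<in> loc_max" using sy by simp
  thus False using loc_max_algebraic_int_iff y by blast
qed

definition loc_unit :: "'a \<Rightarrow> bool" where
  "loc_unit u \<longleftrightarrow> u \<in> loc \<and> u \<notin> loc_max"

lemma loc_unit_nonzero: "loc_unit u \<Longrightarrow> u \<noteq> 0"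
  using loc_max_P[OF P_zero] by (auto simp: loc_unit_def)

lemma loc_unit_mult: "loc_unit u \<Longrightarrow> loc_unit v \<Longrightarrow> loc_unit (u * v)"
  unfolding loc_unit_def
proof (intro conjI notI; elim conjE)
  assume u: "u \<in> loc" "u \<notin> loc_max" and v: "v \<in> loc" "v \<notin> loc_max"
  show "u * v \<in> loc" using u v by (intro loc_mult)
  assume "u * v \<in> loc_max"
  hence "inverse u * (u * v) \<in> loc_max" by (rule loc_max_mult[OF loc_inverse[OF u]])
  moreover have "u \<noteq> 0" using u loc_max_P[OF P_zero] by auto
  hence "inverse u * (u * v) = v" by simp
  ultimately show False using v(2) by simp
qed

lemma loc_unit_inverse: assumes "loc_unit u" shows "loc_unit (inverse u)"
proof -
  have "inverse u \<in> loc" using assms loc_inverse by (simp add: loc_unit_def)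
  moreover have "inverse u \<notin> loc_max"
    using loc_max_mult[of u "inverse u"] assms loc_unit_nonzero[OF assms] one_notin_loc_max
    by (auto simp: loc_unit_def)
  ultimately show ?thesis by (simp add: loc_unit_def)
qed

lemma algebraic_int_factor_uniformizer:
  assumes "algebraic_int a" "a \<noteq> 0"
  obtains n u where "loc_unit u" "a = u * \<pi> ^ n"
proof -
  define n where "n = (LEAST n. a / \<pi> ^ n \<notin> loc)"
  have n: "a / \<pi> ^ n \<notin> loc"
    unfolding n_def using uniformizer_powers_separated[OF assms] by (rule LeastI_ex)
  hence "n \<noteq> 0" using assms(1) loc_algebraic_int by (intro notI) simp
  then obtain k where k: "n = Suc k" using not0_implies_Suc by blast
  have "a / \<pi> ^ k \<in> loc"
    using not_less_Least[of k "\<lambda>n. a / \<pi> ^ n \<notin> loc"] k by (auto simp flip: n_def)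
  moreover have "a / \<pi> ^ k \<notin> loc_max"
    using loc_max_div_uniformizer[of "a / \<pi> ^ k"] n k by (auto simp: mult.commute)
  ultimately have "loc_unit (a / \<pi> ^ k)" by (simp add: loc_unit_def)
  thus thesis using that[of "a / \<pi> ^ k" k] uniformizer_nonzero by simp
qed

lemma unit_times_power_cancel:
  assumes "loc_unit u" "loc_unit v" "u * \<pi> ^ m = v * \<pi> ^ n"
  shows "m = n"
proof -
  have *: "\<not> m < n" if "loc_unit u" "loc_unit v" "u * \<pi> ^ m = v * \<pi> ^ n" for u v m n
  proof
    assume "m < n"
    hence "\<pi> ^ n = \<pi> ^ (n - m) * \<pi> ^ m" by (simp flip: power_add)
    hence "u = v * \<pi> ^ (n - m)" using that(3) uniformizer_nonzero by (simp flip: mult.assoc)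
    thus False using mult_uniformizer[of v "n - m"] that(1,2) \<open>m < n\<close>
      by (auto simp: loc_unit_def)
  qed
  show ?thesis using *[of u v m n] *[of v u n m] assms by auto
qed

definition P_pow :: "nat \<Rightarrow> 'a set" where
  "P_pow n = P [^]\<^bsub>ideals_set \<O>\<^esub> n"

lemma P_pow_0: "P_pow 0 = {x. algebraic_int x}"
  and P_pow_Suc: "P_pow (Suc n) = P_pow n \<cdot>\<^bsub>\<O>\<^esub> P"
  by (simp_all add: P_pow_def nat_pow_def ideals_set_def)

lemma P_pow_ideal: "ideal (P_pow n) \<O>"
proof (induction n)
  case 0
  show ?case using P.oneideal by (simp add: P_pow_0)
next
  case (Suc n)
  show ?case unfolding P_pow_Suc by (rule P.ideal_prod_is_ideal[OF Suc P.ideal_axioms])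
qed

lemma P_pow_add: "x \<in> P_pow n \<Longrightarrow> y \<in> P_pow n \<Longrightarrow> x + y \<in> P_pow n"
  using additive_subgroup.a_closed[OF ideal.axioms(1)[OF P_pow_ideal], of x n y] by simp

lemma P_pow_mult: "x \<in> P_pow n \<Longrightarrow> algebraic_int a \<Longrightarrow> a * x \<in> P_pow n"
  using ideal.I_l_closed[OF P_pow_ideal, of x n a] by simp

lemma power_in_P_pow: assumes "x \<in> P" shows "x ^ n \<in> P_pow n"
proof (induction n)
  case (Suc n)
  thus ?case unfolding P_pow_Suc
    using ideal_prod.prod[of "x ^ n" "P_pow n" x P \<O>] assms by (simp add: mult.commute)
qed (simp add: P_pow_0)

text \<open>
  Powers of a maximal ideal are primary. With \<open>r = 1 - s * t \<in> P\<close> the geometric sum shows that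
  \<open>1 - r ^ n\<close> is a multiple of \<open>s\<close>, whereas \<open>r ^ n\<close> is in the \<open>n\<close>-th power of \<open>P\<close>.
\<close>
lemma P_pow_cancel:
  assumes "algebraic_int a" "algebraic_int s" "s \<notin> P" "s * a \<in> P_pow n"
  shows "a \<in> P_pow n"
proof -
  obtain t where t: "algebraic_int t" "s * t - 1 \<in> P" using P_inverse assms by blast
  define r where "r = 1 - s * t"
  have r: "r \<in> P" using P_minus[OF t(2)] by (simp add: r_def)
  define u where "u = t * (\<Sum>i<n. r ^ i)"
  have "1 - r ^ n = s * u"
    using one_diff_power_eq[of r n] by (simp add: r_def u_def mult_ac)
  hence "s * u + r ^ n = 1" by (metis diff_add_cancel)
  hence "(s * u + r ^ n) * a = a" by simp
  hence "a = u * (s * a) + a * r ^ n" by (simp add: algebra_simps)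
  moreover have "algebraic_int u"
    unfolding u_def using t(1) P_algebraic_int[OF r]
    by (intro algebraic_int_mult algebraic_int_sum algebraic_int_power)
  ultimately show ?thesis
    using P_pow_add[OF P_pow_mult[OF assms(4)] P_pow_mult[OF power_in_P_pow[OF r] assms(1)], of u]
    by simp
qed

text \<open>
  Membership in a power of \<open>P\<close> is divisibility by a power of \<open>\<pi>\<close>. This translates the order
  of an algebraic integer, which is defined by ideals, into an exponent.
\<close>
lemma P_pow_iff:
  assumes "algebraic_int a"
  shows "a \<in> P_pow n \<longleftrightarrow> a / \<pi> ^ n \<in> loc"
proof
  assume "a \<in> P_pow n"
  thus "a / \<pi> ^ n \<in> loc"
  proof (induction n arbitrary: a)
    case 0
    thus ?case by (simp add: P_pow_0 loc_algebraic_int)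
  next
    case (Suc n)
    from Suc.prems have "a \<in> P_pow n \<cdot>\<^bsub>\<O>\<^esub> P" by (simp add: P_pow_Suc)
    thus ?case
    proof (induction rule: ideal_prod.induct)
      case (prod i j)
      have "i / \<pi> ^ n * (j / \<pi>) \<in> loc"
        using prod Suc.IH by (intro loc_mult loc_max_div_uniformizer loc_max_P) auto
      thus ?case by (simp add: mult.commute)
    next
      case (sum x y)
      thus ?case using loc_add by (simp add: add_divide_distrib)
    qed
  qed
next
  assume "a / \<pi> ^ n \<in> loc"
  then obtain y s where y: "a / \<pi> ^ n = y / s" "algebraic_int y" "algebraic_int s" "s \<notin> P" "s \<noteq> 0"
    by (rule locE)
  have "s * a = y * \<pi> ^ n"
    using y(1,5) uniformizer_nonzero by (simp add: field_simps)
  moreover have "y * \<pi> ^ n \<in> P_pow n"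
    using P_pow_mult[OF power_in_P_pow[OF uniformizer(1)] y(2)] .
  ultimately show "a \<in> P_pow n" using P_pow_cancel[OF assms y(3,4)] by simp
qed

lemma integer_ord_eq:
  assumes "loc_unit u" "algebraic_int (u * \<pi> ^ n)"
  shows "integer_ord P (u * \<pi> ^ n) = n"
  unfolding integer_ord_def P_pow_def[symmetric] P_pow_iff[OF assms(2)]
proof (rule Greatest_equality)
  show "u * \<pi> ^ n / \<pi> ^ n \<in> loc"
    using assms(1) uniformizer_nonzero by (simp add: loc_unit_def)
  fix m assume m: "u * \<pi> ^ n / \<pi> ^ m \<in> loc"
  show "m \<le> n"
  proof (rule ccontr)
    assume "\<not> m \<le> n"
    hence "u * \<pi> ^ n / \<pi> ^ m * \<pi> ^ (m - n) \<in> loc_max" using m by (intro mult_uniformizer) auto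
    moreover have "\<pi> ^ n * \<pi> ^ (m - n) = \<pi> ^ m" using \<open>\<not> m \<le> n\<close> by (simp flip: power_add)
    hence "u * \<pi> ^ n / \<pi> ^ m * \<pi> ^ (m - n) = u"
      using uniformizer_nonzero by (simp add: mult.assoc)
    ultimately show False using assms(1) by (simp add: loc_unit_def)
  qed
qed

text \<open>
  Numerator and denominator of a fraction are units times powers of \<open>\<pi>\<close>, and the difference of
  the exponents is the same for all fractions that represent \<open>x\<close>. The exponent of the denominator
  stands on the left-hand side, so that no negative powers occur.
\<close>
lemma valuation_eq:
  assumes "x \<noteq> 0"
  obtains u i j where "loc_unit u" "x * \<pi> ^ j = u * \<pi> ^ i" "valuation P x = Fin (int i - int j)"
proof -
  obtain a b where ab: "algebraic_int a" "algebraic_int b" "b \<noteq> 0" "x = a / b"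
    using fraction_of_algebraic_ints .
  have "a \<noteq> 0" using ab assms by auto
  obtain i u where u: "loc_unit u" "a = u * \<pi> ^ i"
    using algebraic_int_factor_uniformizer[OF ab(1) \<open>a \<noteq> 0\<close>] .
  obtain j w where w: "loc_unit w" "b = w * \<pi> ^ j"
    using algebraic_int_factor_uniformizer[OF ab(2,3)] .
  have ord: "integer_ord P a = i" "integer_ord P b = j"
    using integer_ord_eq u w ab by auto
  have "(THE n. \<exists>a b. a \<in> carrier \<O> - {0} \<and> b \<in> carrier \<O> - {0} \<and> x = a / b \<and>
      n = int (integer_ord P a) - int (integer_ord P b)) = int i - int j"
  proof (rule the_equality)
    show "\<exists>a b. a \<in> carrier \<O> - {0} \<and> b \<in> carrier \<O> - {0} \<and> x = a / b \<and>
      int i - int j = int (integer_ord P a) - int (integer_ord P b)"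
      using ab \<open>a \<noteq> 0\<close> ord by (intro exI[of _ a] exI[of _ b]) auto
  next
    fix n assume "\<exists>a b. a \<in> carrier \<O> - {0} \<and> b \<in> carrier \<O> - {0} \<and> x = a / b \<and>
      n = int (integer_ord P a) - int (integer_ord P b)"
    then obtain a' b' where ab': "algebraic_int a'" "a' \<noteq> 0" "algebraic_int b'" "b' \<noteq> 0"
      "x = a' / b'" "n = int (integer_ord P a') - int (integer_ord P b')" by auto
    obtain i' u' where u': "loc_unit u'" "a' = u' * \<pi> ^ i'"
      using algebraic_int_factor_uniformizer[OF ab'(1,2)] .
    obtain j' w' where w': "loc_unit w'" "b' = w' * \<pi> ^ j'"
      using algebraic_int_factor_uniformizer[OF ab'(3,4)] .
    have "a * b' = a' * b" using ab(3,4) ab'(4,5) by (simp add: field_simps)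
    hence "(u * w') * \<pi> ^ (i + j') = (u' * w) * \<pi> ^ (i' + j)"
      unfolding u w u' w' by (simp add: power_add mult_ac)
    hence "i + j' = i' + j"
      by (rule unit_times_power_cancel[rotated 2]) (use u w u' w' in \<open>auto intro: loc_unit_mult\<close>)
    moreover have "integer_ord P a' = i'" "integer_ord P b' = j'"
      using integer_ord_eq u' w' ab' by auto
    ultimately show "n = int i - int j" using ab'(6) by simp
  qed
  hence val: "valuation P x = Fin (int i - int j)" using assms by (simp add: valuation_def)
  have "w \<noteq> 0" using w loc_unit_nonzero by blast
  hence "x * \<pi> ^ j = (u * inverse w) * \<pi> ^ i"
    using ab(4) u(2) w(2) uniformizer_nonzero by (simp add: field_simps)
  thus thesis using that val u(1) w(1) by (blast intro: loc_unit_mult loc_unit_inverse)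
qed

text \<open>
  Only these consequences enter the dynamics. The last one says that \<open>loc\<close> is a valuation ring.
\<close>
lemma valuation_cases:
  "(valuation P x \<ge> 0 \<longrightarrow> x \<in> loc) \<and> (valuation P x > 0 \<longrightarrow> x \<in> loc_max) \<and>
   (x \<in> loc_max \<longrightarrow> valuation P x \<ge> 1) \<and> (x \<notin> loc \<longrightarrow> inverse x \<in> loc_max)"
proof (cases "x = 0")
  case True
  have "0 \<in> loc_max" using P_zero by (rule loc_max_P)
  thus ?thesis using True loc_max_loc by (simp add: valuation_def)
next
  case False
  obtain u i j where v: "loc_unit u" "x * \<pi> ^ j = u * \<pi> ^ i" "valuation P x = Fin (int i - int j)"
    using valuation_eq[OF False] .
  have up: "x = u * \<pi> ^ (i - j)" if "j \<le> i"
  proof -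
    have "\<pi> ^ i = \<pi> ^ (i - j) * \<pi> ^ j" using that by (simp flip: power_add)
    thus ?thesis using v(2) uniformizer_nonzero by (simp flip: mult.assoc)
  qed
  have loc: "x \<in> loc" if "j \<le> i"
    unfolding up[OF that] using v(1) unfolding loc_unit_def
    by (intro loc_mult uniformizer_power_loc) auto
  have max: "x \<in> loc_max" if "j < i"
    using mult_uniformizer[of u "i - j"] up v(1) that by (simp add: loc_unit_def)
  have down: "x * \<pi> ^ (j - i) = u" if "i \<le> j"
  proof -
    have "\<pi> ^ j = \<pi> ^ (j - i) * \<pi> ^ i" using that by (simp flip: power_add)
    thus ?thesis using v(2) uniformizer_nonzero by (simp flip: mult.assoc)
  qed
  have "j < i" if "x \<in> loc_max"
  proof (rule ccontr)
    assume "\<not> j < i"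
    moreover have "\<pi> ^ (j - i) * x \<in> loc_max"
      using that by (intro loc_max_mult uniformizer_power_loc)
    ultimately show False using down v(1) by (simp add: loc_unit_def mult.commute)
  qed
  moreover have "inverse x \<in> loc_max" if "x \<notin> loc"
  proof -
    have "i < j" using that loc by force
    hence "inverse x = inverse u * \<pi> ^ (j - i)"
      using down False uniformizer_nonzero by (auto simp: field_simps)
    moreover have "inverse u \<in> loc" using loc_unit_inverse[OF v(1)] by (simp add: loc_unit_def)
    ultimately show ?thesis using mult_uniformizer \<open>i < j\<close> by simp
  qed
  ultimately show ?thesis using loc max v(3) by (auto simp: zero_extended_def one_extended_def)
qed

end

context number_field_prime
begin

lemma valuation_nonneg: "valuation P x \<ge> 0 \<Longrightarrow> x \<in> loc"
  and valuation_pos: "valuation P x > 0 \<Longrightarrow> x \<in> loc_max"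
  and valuation_ge_1: "x \<in> loc_max \<Longrightarrow> valuation P x \<ge> 1"
  and inverse_in_loc_max: "x \<notin> loc \<Longrightarrow> inverse x \<in> loc_max"
proof -
  obtain \<pi> s where "\<pi> \<in> P" "algebraic_int s" "s \<notin> P"
    "\<And>x. x \<in> P \<Longrightarrow> \<exists>y. algebraic_int y \<and> s * x = \<pi> * y"
    using exists_uniformizer by blast
  then interpret number_field_prime_uniformizer P p \<pi> s by unfold_locales
  show "valuation P x \<ge> 0 \<Longrightarrow> x \<in> loc" "valuation P x > 0 \<Longrightarrow> x \<in> loc_max"
    "x \<in> loc_max \<Longrightarrow> valuation P x \<ge> 1" "x \<notin> loc \<Longrightarrow> inverse x \<in> loc_max"
    using valuation_cases by blast+
qed

end

section \<open>The residue field\<close>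

text \<open>
  In a line extension the coefficient of the new vector \<open>v\<close> is unique, because otherwise \<open>v\<close>
  would already lie in the smaller space; so each dimension contributes a factor \<open>card K\<close>.
\<close>
lemma (in ring) card_of_dimension:
  assumes K: "subfield K R" "finite K" and dim: "dimension n K E"
  shows "finite E \<and> card E = card K ^ n"
  using dim
proof (induction n arbitrary: E)
  case 0
  thus ?case using dimension_zero[OF K(1) 0] by simp
next
  case (Suc n)
  obtain v E' where v: "v \<in> carrier R" "dimension n K E'" "v \<notin> E'" "E = line_extension K v E'"
    using dimension_backwards[OF K(1) Suc.prems] by blast
  note sub = space_subgroup_props[OF K(1) v(2)]
  note Kc = subringE[OF subfieldE(1)[OF K(1)]]
  have IH: "finite E'" "card E' = card K ^ n" using Suc.IH[OF v(2)] by auto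
  have E: "E = (\<lambda>(k, e). k \<otimes> v \<oplus> e) ` (K \<times> E')"
    unfolding v(4) by (auto simp: line_extension_mem_iff image_iff) blast
  have "inj_on (\<lambda>(k, e). k \<otimes> v \<oplus> e) (K \<times> E')"
  proof (rule inj_onI, clarify)
    fix k e k' e' assume k: "k \<in> K" "k' \<in> K" and e: "e \<in> E'" "e' \<in> E'"
      and eq: "k \<otimes> v \<oplus> e = k' \<otimes> v \<oplus> e'"
    have carr: "k \<in> carrier R" "k' \<in> carrier R" "e \<in> carrier R" "e' \<in> carrier R"
      using k e Kc(1) sub(1) by auto
    have "(k \<ominus> k') \<otimes> v = (k \<otimes> v \<oplus> e) \<ominus> (k' \<otimes> v \<oplus> e') \<oplus> (e' \<ominus> e)"
      using carr v(1) by algebra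
    also have "\<dots> = e' \<ominus> e"
      unfolding eq using carr v(1) by algebra
    finally have "(k \<ominus> k') \<otimes> v \<in> E'"
      using e sub(3,4) by (simp add: a_minus_def)
    moreover have "k \<ominus> k' \<in> K" using k Kc(5,7) by (simp add: a_minus_def)
    ultimately have "k \<ominus> k' = \<zero>" using sub(6)[of "k \<ominus> k'" v] v(1,3) by blast
    hence "k = k'" using carr by simp
    thus "k = k' \<and> e = e'" using eq carr v(1) by simp
  qed
  thus ?case unfolding E using IH K(2) by (auto simp: card_image card_cartesian_product)
qed

context number_field_prime
begin

abbreviation residue_field :: "'a set ring" where
  "residue_field \<equiv> \<O> Quot P"

abbreviation residue :: "'a \<Rightarrow> 'a set" where
  "residue x \<equiv> P +>\<^bsub>\<O>\<^esub> x"

sublocale residue: ring_hom_cring \<O> residue_field residue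
  using P.rcos_ring_hom_cring .

lemma residue_eq_iff:
  assumes "algebraic_int x" "algebraic_int y"
  shows "residue x = residue y \<longleftrightarrow> x - y \<in> P"
proof -
  have "\<ominus>\<^bsub>\<O>\<^esub> y = - y"
    using cring.sum_zero_eq_neg[OF cring_ring_of_integers, of "- y" y] assms by simp
  hence "x \<ominus>\<^bsub>\<O>\<^esub> y = x - y" by (simp add: a_minus_def)
  thus ?thesis
    using P.quotient_eq_iff_same_a_r_cos[OF P.ideal_axioms, of x y] assms by simp
qed

lemma carrier_residue_field: "carrier residue_field = residue ` {x. algebraic_int x}"
  by (auto simp: FactRing_def A_RCOSETS_def' )

lemma residue_zero: "\<zero>\<^bsub>residue_field\<^esub> = residue 0"
  using residue.hom_zero by simp

lemma residue_one: "\<one>\<^bsub>residue_field\<^esub> = residue 1"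
  using residue.hom_one by simp

lemma field_residue_field: "field residue_field"
proof (rule residue.S.cring_fieldI2)
  show "\<zero>\<^bsub>residue_field\<^esub> \<noteq> \<one>\<^bsub>residue_field\<^esub>"
    using residue_eq_iff[of 1 0] one_notin_P by (simp add: residue_zero residue_one)
next
  fix a assume "a \<in> carrier residue_field" "a \<noteq> \<zero>\<^bsub>residue_field\<^esub>"
  then obtain x where x: "a = residue x" "algebraic_int x" "x \<notin> P"
    using residue_eq_iff[of _ 0] by (auto simp: carrier_residue_field residue_zero)
  obtain t where t: "algebraic_int t" "x * t - 1 \<in> P" using P_inverse x by blast
  have "a \<otimes>\<^bsub>residue_field\<^esub> residue t = residue (x * t)"
    using residue.hom_mult[of x t] x t by simp
  also have "\<dots> = \<one>\<^bsub>residue_field\<^esub>"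
    using residue_eq_iff[of "x * t" 1] x t by (auto simp: residue_one)
  finally show "\<exists>b\<in>carrier residue_field. a \<otimes>\<^bsub>residue_field\<^esub> b = \<one>\<^bsub>residue_field\<^esub>"
    using t(1) by (auto simp: carrier_residue_field)
qed

lemma finite_residue_field: "finite (carrier residue_field)"
proof -
  obtain T :: "'a set" where T: "finite T" "\<And>x. algebraic_int x \<Longrightarrow>
    \<exists>t\<in>T. algebraic_int t \<and> algebraic_int ((x - t) / of_nat p)"
    using finite_int_quotient[OF number_field prime_gt_0_nat[OF prime_p]]
    unfolding finite_int_quotient_def by blast
  have "residue x \<in> residue ` T" if x: "algebraic_int x" for x
  proof -
    obtain t where t: "t \<in> T" "algebraic_int t" "algebraic_int ((x - t) / of_nat p)"
      using T(2)[OF x] by blast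
    have "x - t \<in> P" using P_mult'[OF p_in_P t(3)] p_nonzero by simp
    hence "residue x = residue t" using residue_eq_iff[OF x t(2)] by (rule iffD2[rotated])
    thus ?thesis using t(1) by (rule image_eqI)
  qed
  hence "carrier residue_field \<subseteq> residue ` T" by (auto simp: carrier_residue_field)
  thus ?thesis by (rule finite_subset) (simp add: T(1))
qed

lemma residue_Ints: "residue ` \<int> = (\<lambda>n. residue (of_int n)) ` {0..<int p}"
proof -
  have "residue (of_int n) = residue (of_int (n mod int p))" for n
  proof -
    have "of_int n - of_int (n mod int p) = (of_int (n - n mod int p) :: 'a)" by simp
    also have "\<dots> \<in> P" by (simp only: of_int_in_P_iff) simp
    finally show ?thesis by (subst residue_eq_iff) auto
  qed
  moreover have "n mod int p \<in> {0..<int p}" for n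
    using prime_p by (auto simp: prime_gt_0_nat)
  ultimately have "residue (of_int n) \<in> (\<lambda>n. residue (of_int n)) ` {0..<int p}" for n
    by (metis (no_types, lifting) image_eqI)
  thus ?thesis by (auto elim!: Ints_cases)
qed

lemma card_residue_Ints: "card (residue ` \<int>) = p"
proof -
  have "inj_on (\<lambda>n. residue (of_int n)) {0..<int p}"
  proof (rule inj_onI)
    fix m n assume mn: "m \<in> {0..<int p}" "n \<in> {0..<int p}"
      and eq: "residue (of_int m) = residue (of_int n)"
    have "of_int (m - n) \<in> P" using eq residue_eq_iff[of "of_int m" "of_int n"] by simp
    hence "m mod int p = n mod int p" by (simp only: of_int_in_P_iff mod_eq_dvd_iff)
    thus "m = n" using mn by simp
  qed
  thus ?thesis unfolding residue_Ints by (simp add: card_image)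
qed

lemma subfield_residue_Ints: "subfield (residue ` \<int>) residue_field"
proof -
  interpret F: field residue_field by (rule field_residue_field)
  have "subring (\<int> :: 'a set) \<O>"
  proof (rule P.subringI)
    fix h :: 'a assume h: "h \<in> \<int>"
    hence "\<ominus>\<^bsub>\<O>\<^esub> h = - h"
      using cring.sum_zero_eq_neg[OF cring_ring_of_integers, of "- h" h] int_imp_algebraic_int[OF h] by auto
    thus "\<ominus>\<^bsub>\<O>\<^esub> h \<in> \<int>" using h by simp
  qed (auto intro: int_imp_algebraic_int)
  hence sub: "subring (residue ` \<int>) residue_field"
    by (rule ring_hom_ring.img_is_subring[OF P.rcos_ring_hom_ring])
  show ?thesis
  proof (rule F.subfieldI'[OF sub])
    fix k assume k: "k \<in> residue ` \<int> - {\<zero>\<^bsub>residue_field\<^esub>}"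
    then obtain n where n: "k = residue (of_int n)" by (auto elim: Ints_cases)
    have "\<not> int p dvd n"
      using k residue_eq_iff[of "of_int n" 0] of_int_in_P_iff[of n] by (auto simp: n residue_zero)
    hence "coprime n (int p)"
      using prime_imp_coprime[of "int p" n] prime_p by (simp add: coprime_commute)
    then obtain m l where ml: "m * n + l * int p = 1" using bezout_int[of n "int p"] by auto
    have "of_int n * of_int m - 1 = (of_int (n * m - 1) :: 'a)" by simp
    also have "n * m - 1 = int p * (- l)" using ml by (simp add: algebra_simps)
    also have "of_int \<dots> \<in> P" by (simp only: of_int_in_P_iff) simp
    finally have "residue (of_int n * of_int m) = residue 1"
      by (subst residue_eq_iff) (auto simp flip: of_int_mult)
    hence "k \<otimes>\<^bsub>residue_field\<^esub> residue (of_int m) = \<one>\<^bsub>residue_field\<^esub>"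
      using residue.hom_mult[of "of_int n" "of_int m"] by (simp add: n residue_one)
    hence "inv\<^bsub>residue_field\<^esub> k = residue (of_int m)"
      by (intro residue.S.comm_inv_char) (auto simp: n carrier_residue_field)
    thus "inv\<^bsub>residue_field\<^esub> k \<in> residue ` \<int>" by simp
  qed
qed

text \<open>
  The finite set of all residues spans the residue field over its prime field, so the dimension
  that defines the residue degree exists.
\<close>
lemma card_residue_field: "card (carrier residue_field) = p ^ residue_degree P"
proof -
  interpret F: field residue_field by (rule field_residue_field)
  note sub = subfield_residue_Ints
  obtain Us where Us: "set Us = carrier residue_field"
    using finite_residue_field finite_list by blast
  have "residue.S.Span (residue ` \<int>) Us = carrier residue_field"
    using residue.S.Span_base_incl[OF sub, of Us] residue.S.Span_in_carrier[of "residue ` \<int>" Us]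
      subringE(1)[OF subfieldE(1)[OF sub]] Us by blast
  hence fin: "residue.S.finite_dimension (residue ` \<int>) (carrier residue_field)"
    using residue.S.Span_finite_dimension[OF sub, of Us] Us by simp
  have "residue.S.dimension (residue.S.dim (residue ` \<int>) (carrier residue_field)) (residue ` \<int>) (carrier residue_field)"
    unfolding residue.S.dim_def by (rule theI'[OF residue.S.unique_dimension[OF sub fin]])
  hence "residue.S.dimension (residue_degree P) (residue ` \<int>) (carrier residue_field)"
    by (simp add: residue_degree_def Let_def)
  moreover have "finite (residue ` \<int>)" unfolding residue_Ints by simp
  ultimately show ?thesis
    using residue.S.card_of_dimension[OF sub] card_residue_Ints by metis
qed

lemma residue_degree_pos: "residue_degree P > 0"
proof (rule ccontr)
  assume "\<not> residue_degree P > 0"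
  hence "card (carrier residue_field) = 1" using card_residue_field by simp
  then obtain c where "carrier residue_field = {c}" by (rule card_1_singletonE)
  moreover have "residue 0 \<in> carrier residue_field" "residue 1 \<in> carrier residue_field"
    by (auto simp: carrier_residue_field)
  ultimately have "residue 1 = residue 0" by auto
  thus False using residue_eq_iff[of 1 0] one_notin_P by simp
qed

text \<open>
  Lagrange's theorem in the unit group of the residue field.
\<close>
lemma P_fermat:
  assumes "algebraic_int x"
  shows "x ^ (p ^ residue_degree P) - x \<in> P"
proof (cases "x \<in> P")
  case True
  have "p ^ residue_degree P > 0" using prime_p by (simp add: prime_gt_0_nat)
  hence "x ^ (p ^ residue_degree P) = x ^ (p ^ residue_degree P - 1) * x"
    using power_minus_mult[of "p ^ residue_degree P" x] by simp
  also have "\<dots> \<in> P" using True assms by (intro P_mult algebraic_int_power)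
  finally show ?thesis using True by (rule P_diff)
next
  case False
  interpret F: field residue_field by (rule field_residue_field)
  let ?q = "p ^ residue_degree P"
  have units: "Units residue_field = carrier residue_field - {\<zero>\<^bsub>residue_field\<^esub>}"
    by (rule F.field_Units)
  have "card (Units residue_field) = ?q - 1"
    unfolding units using card_residue_field finite_residue_field by (simp add: card_Diff_singleton)
  moreover have "residue x \<in> Units residue_field"
    unfolding units using assms False residue_eq_iff[of x 0]
    by (auto simp: carrier_residue_field residue_zero)
  ultimately have "residue x [^]\<^bsub>residue_field\<^esub> (?q - 1) = \<one>\<^bsub>residue_field\<^esub>"
    using residue.S.units_power_order_eq_one[of "residue x"] finite_residue_field by (simp add: units)
  moreover have "residue x [^]\<^bsub>residue_field\<^esub> n = residue (x ^ n)" for n :: nat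
  proof (induction n)
    case (Suc n)
    thus ?case using residue.hom_mult[of "x ^ n" x] assms by (auto simp: mult.commute)
  qed (simp add: residue_one)
  ultimately have "x ^ (?q - 1) - 1 \<in> P"
    using residue_eq_iff[of "x ^ (?q - 1)" 1] assms by (auto simp: residue_one)
  hence "x * (x ^ (?q - 1) - 1) \<in> P" using assms by (rule P_mult)
  moreover have "?q > 0" using prime_p by (simp add: prime_gt_0_nat)
  hence "x ^ ?q = x * x ^ (?q - 1)"
    using power_minus_mult[of ?q x] by (simp add: mult.commute)
  ultimately show ?thesis by (simp add: right_diff_distrib)
qed

end

section \<open>Polynomials that reduce to a power of Frobenius plus a constant\<close>

text \<open>
  The dynamical part of the argument takes place in a valuation ring \<open>R\<close> with maximal ideal \<open>M\<close>
  whose residue field has characteristic \<open>p\<close>.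
\<close>
locale residue_char_valuation_ring =
  fixes R M :: "'a::field_char_0 set" and p :: nat
  assumes R_one: "1 \<in> R" and R_add: "x \<in> R \<Longrightarrow> y \<in> R \<Longrightarrow> x + y \<in> R"
    and R_mult: "x \<in> R \<Longrightarrow> y \<in> R \<Longrightarrow> x * y \<in> R" and R_minus: "x \<in> R \<Longrightarrow> - x \<in> R"
    and M_subset: "M \<subseteq> R" and M_zero: "0 \<in> M"
    and M_add: "x \<in> M \<Longrightarrow> y \<in> M \<Longrightarrow> x + y \<in> M"
    and M_mult: "x \<in> R \<Longrightarrow> y \<in> M \<Longrightarrow> x * y \<in> M"
    and M_one: "1 \<notin> M"
    and R_inverse: "x \<in> R \<Longrightarrow> x \<notin> M \<Longrightarrow> inverse x \<in> R"
    and M_inverse: "x \<notin> R \<Longrightarrow> inverse x \<in> M"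
    and prime_p: "Factorial_Ring.prime p" and p_M: "of_nat p \<in> M"
begin

definition cong_M :: "'a \<Rightarrow> 'a \<Rightarrow> bool" (infix \<open>\<approx>\<close> 50) where
  "x \<approx> y \<longleftrightarrow> x - y \<in> M"

lemma M_R: "x \<in> M \<Longrightarrow> x \<in> R"
  using M_subset by blast

lemma M_mult': "x \<in> M \<Longrightarrow> y \<in> R \<Longrightarrow> x * y \<in> M"
  using M_mult[of y x] by (simp add: mult.commute)

lemma M_minus: "x \<in> M \<Longrightarrow> - x \<in> M"
  using M_mult[of "-1" x] R_minus[OF R_one] by simp

lemma R_diff: "x \<in> R \<Longrightarrow> y \<in> R \<Longrightarrow> x - y \<in> R"
  using R_add[of x "- y"] R_minus by simp

lemma R_power: "x \<in> R \<Longrightarrow> x ^ n \<in> R"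
  by (induction n) (auto intro: R_one R_mult)

lemma M_power: "x \<in> M \<Longrightarrow> n > 0 \<Longrightarrow> x ^ n \<in> M"
  using M_mult[of "x ^ (n - 1)" x] power_minus_mult[of n x] M_R R_power by simp

lemma R_of_nat: "of_nat n \<in> R"
  by (induction n) (auto intro: R_one R_add M_R M_zero)

lemma R_of_int: "of_int n \<in> R"
  using R_of_nat by (cases n) (auto intro!: R_minus R_diff R_of_nat R_one R_add simp del: of_nat_Suc)

lemma R_sum: "(\<And>i. i \<in> A \<Longrightarrow> f i \<in> R) \<Longrightarrow> sum f A \<in> R"
  by (induction A rule: infinite_finite_induct) (auto intro: R_add M_R M_zero)

lemma M_sum: "(\<And>i. i \<in> A \<Longrightarrow> f i \<in> M) \<Longrightarrow> sum f A \<in> M"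
  by (induction A rule: infinite_finite_induct) (auto intro: M_add M_zero)

lemma cong_refl [simp]: "x \<approx> x"
  by (simp add: cong_M_def M_zero)

lemma cong_sym: "x \<approx> y \<Longrightarrow> y \<approx> x"
  using M_minus[of "x - y"] by (simp add: cong_M_def)

lemma cong_trans [trans]: "x \<approx> y \<Longrightarrow> y \<approx> z \<Longrightarrow> x \<approx> z"
  using M_add[of "x - y" "y - z"] by (simp add: cong_M_def)

lemma cong_add: "x \<approx> y \<Longrightarrow> x' \<approx> y' \<Longrightarrow> x + x' \<approx> y + y'"
  using M_add[of "x - y" "x' - y'"] by (simp add: cong_M_def algebra_simps)

lemma cong_mult:
  assumes "x \<approx> y" "x' \<approx> y'" "x \<in> R" "y' \<in> R"
  shows "x * x' \<approx> y * y'"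
proof -
  have "x * x' - y * y' = x * (x' - y') + (x - y) * y'" by (simp add: algebra_simps)
  also have "\<dots> \<in> M" using assms by (intro M_add M_mult M_mult') (auto simp: cong_M_def)
  finally show ?thesis by (simp add: cong_M_def)
qed

lemma cong_power: "x \<approx> y \<Longrightarrow> x \<in> R \<Longrightarrow> y \<in> R \<Longrightarrow> x ^ n \<approx> y ^ n"
  by (induction n) (auto intro: cong_mult R_power)

lemma cong_M_iff: "x \<approx> y \<Longrightarrow> x \<in> M \<longleftrightarrow> y \<in> M"
  using M_add[of "x - y" y] M_add[of "- (x - y)" x] M_minus[of "x - y"]
  by (auto simp: cong_M_def)

lemma cong_cancel:
  assumes "x * s \<approx> y * s" "s \<in> R" "s \<notin> M"
  shows "x \<approx> y"
proof -
  have "s \<noteq> 0" using assms(3) M_zero by auto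
  have "(x * s - y * s) * inverse s \<in> M"
    using assms R_inverse by (intro M_mult') (auto simp: cong_M_def)
  also have "(x * s - y * s) * inverse s = x - y" using \<open>s \<noteq> 0\<close> by (simp add: field_simps)
  finally show ?thesis by (simp add: cong_M_def)
qed

text \<open>
  The inner binomial coefficients of a prime are divisible by it.
\<close>
lemma frobenius_add:
  assumes "x \<in> R" "y \<in> R"
  shows "(x + y) ^ p \<approx> x ^ p + y ^ p"
proof -
  have p: "p > 0" using prime_p by (simp add: prime_gt_0_nat)
  let ?t = "\<lambda>k. of_nat (p choose k) * x ^ k * y ^ (p - k)"
  have "(x + y) ^ p = (\<Sum>k\<le>p. ?t k)" by (rule binomial_ring)
  also have "{..p} = insert 0 (insert p {0<..<p})" using p by auto
  also have "sum ?t \<dots> = y ^ p + (x ^ p + (\<Sum>k\<in>{0<..<p}. ?t k))"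
    using p by (subst sum.insert; (subst sum.insert)?) auto
  finally have "(x + y) ^ p - (x ^ p + y ^ p) = (\<Sum>k\<in>{0<..<p}. ?t k)" by simp
  also have "\<dots> \<in> M"
  proof (rule M_sum)
    fix k assume "k \<in> {0<..<p}"
    hence "p dvd (p choose k)" using prime_p by (intro dvd_choose_prime) auto
    then obtain c where "p choose k = p * c" by (elim dvdE)
    moreover have "of_nat p * (of_nat c * x ^ k * y ^ (p - k)) \<in> M"
      using assms by (intro M_mult' p_M R_mult R_of_nat R_power)
    ultimately show "?t k \<in> M" by (simp add: mult_ac)
  qed
  finally show ?thesis by (simp add: cong_M_def)
qed

lemma frobenius_add_iterate:
  assumes "x \<in> R" "y \<in> R"
  shows "(x + y) ^ (p ^ n) \<approx> x ^ (p ^ n) + y ^ (p ^ n)"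
proof (induction n)
  case (Suc n)
  have "(x + y) ^ (p ^ Suc n) = ((x + y) ^ (p ^ n)) ^ p" by (simp add: power_mult[symmetric] mult.commute)
  also have "\<dots> \<approx> (x ^ (p ^ n) + y ^ (p ^ n)) ^ p"
    using assms by (intro cong_power Suc R_add R_power)
  also have "\<dots> \<approx> (x ^ (p ^ n)) ^ p + (y ^ (p ^ n)) ^ p"
    using assms by (intro frobenius_add R_power)
  finally show ?case by (simp add: power_mult[symmetric] mult.commute)
qed simp

lemma power_iterate_fixed:
  assumes "x ^ q \<approx> x" "x \<in> R"
  shows "x ^ (q ^ n) \<approx> x"
proof (induction n)
  case (Suc n)
  have "x ^ (q ^ Suc n) = (x ^ (q ^ n)) ^ q" by (simp add: power_mult[symmetric] mult.commute)
  also have "\<dots> \<approx> x ^ q" using assms Suc by (intro cong_power R_power)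
  also note assms(1)
  finally show ?case .
qed simp

lemma of_nat_frobenius: "of_nat n ^ (p ^ k) \<approx> of_nat n"
proof (induction n)
  case 0
  have "p ^ k > 0" using prime_p by (simp add: prime_gt_0_nat)
  thus ?case by (simp add: zero_power)
next
  case (Suc n)
  have "of_nat (Suc n) ^ (p ^ k) = (1 + of_nat n) ^ (p ^ k)" by simp
  also have "\<dots> \<approx> 1 ^ (p ^ k) + of_nat n ^ (p ^ k)"
    by (intro frobenius_add_iterate R_one R_of_nat)
  also have "\<dots> \<approx> 1 + of_nat n" using Suc by (intro cong_add) auto
  finally show ?case by simp
qed

lemma of_int_frobenius: "of_int n ^ (p ^ k) \<approx> of_int n"
proof -
  define r where "r = nat (n mod int p)"
  have "of_int n \<approx> of_nat r"
  proof -
    have "n - int r = int p * (n div int p)"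
      using prime_p by (simp add: r_def prime_gt_0_nat minus_mod_eq_mult_div)
    hence "of_int n - of_nat r = (of_nat p * of_int (n div int p) :: 'a)"
      by (metis of_int_diff of_int_mult of_int_of_nat_eq)
    thus ?thesis using M_mult'[OF p_M R_of_int] by (simp add: cong_M_def)
  qed
  hence "of_int n ^ (p ^ k) \<approx> of_nat r ^ (p ^ k)" by (intro cong_power R_of_int R_of_nat)
  also have "\<dots> \<approx> of_nat r" by (rule of_nat_frobenius)
  also have "\<dots> \<approx> of_int n" using \<open>of_int n \<approx> of_nat r\<close> by (rule cong_sym)
  finally show ?thesis .
qed

end

text \<open>
  Modulo \<open>M\<close>, such a polynomial is \<open>X ^ p ^ k + a\<^sub>0\<close>: a power of Frobenius followed by a
  translation.
\<close>
locale frobenius_like_polynomial = residue_char_valuation_ring R M p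
  for R M :: "'a::field_char_0 set" and p +
  fixes \<phi> :: "'a poly" and d k :: nat
  assumes d: "d = p ^ k" and k: "k \<ge> 1"
    and degree: "Polynomial.degree \<phi> = d" and monic: "Polynomial.coeff \<phi> d = 1"
    and coeff_0: "Polynomial.coeff \<phi> 0 \<in> R"
    and coeff_middle: "\<And>i. 0 < i \<Longrightarrow> i < d \<Longrightarrow> Polynomial.coeff \<phi> i \<in> M"
begin

lemma d_ge_2: "d \<ge> 2"
proof -
  have "p ^ 1 \<le> p ^ k" using k prime_ge_1_nat[OF prime_p] by (intro power_increasing)
  thus ?thesis using prime_ge_2_nat[OF prime_p] d by simp
qed

lemma poly_eq: "poly \<phi> x = (\<Sum>i<d. Polynomial.coeff \<phi> i * x ^ i) + x ^ d"
  using monic by (simp add: poly_altdef degree lessThan_Suc_atMost [symmetric])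

lemma coeff_R: "i < d \<Longrightarrow> Polynomial.coeff \<phi> i \<in> R"
  using coeff_0 coeff_middle[of i] M_R by (cases "i = 0") auto

lemma poly_R: "x \<in> R \<Longrightarrow> poly \<phi> x \<in> R"
  unfolding poly_eq by (intro R_add R_sum R_mult R_power coeff_R) auto

lemma iterate_R: "x \<in> R \<Longrightarrow> (poly \<phi> ^^ n) x \<in> R"
  by (induction n) (auto intro: poly_R)

lemma poly_cong:
  assumes "x \<in> R"
  shows "poly \<phi> x \<approx> x ^ d + Polynomial.coeff \<phi> 0"
proof -
  have "{..<d} = insert 0 {0<..<d}" using d_ge_2 by auto
  hence "poly \<phi> x - (x ^ d + Polynomial.coeff \<phi> 0) = (\<Sum>i\<in>{0<..<d}. Polynomial.coeff \<phi> i * x ^ i)"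
    by (simp add: poly_eq)
  also have "\<dots> \<in> M" using assms by (intro M_sum M_mult' coeff_middle R_power) auto
  finally show ?thesis by (simp add: cong_M_def)
qed

lemma d_M: "of_nat d \<in> M"
  unfolding d of_nat_power using k by (intro M_power p_M) auto

text \<open>
  The derivative of \<open>X ^ d + a\<^sub>0\<close> vanishes modulo \<open>p\<close>, so \<open>\<phi>\<close> contracts residue classes. In
  terms of difference quotients: \<open>S i\<close> is that of \<open>X ^ i\<close>, the middle ones are multiplied by
  coefficients in \<open>M\<close>, and \<open>S d\<close> is congruent to \<open>d * x ^ (d - 1)\<close>, where \<open>d \<in> M\<close>.
\<close>
lemma poly_contracting:
  assumes "x \<in> R" "y \<in> R" "x \<approx> y"
  obtains e where "e \<in> M" "poly \<phi> x - poly \<phi> y = (x - y) * e"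
proof -
  define S where "S i = (\<Sum>j<i. y ^ (i - Suc j) * x ^ j)" for i
  have S: "x ^ i - y ^ i = (x - y) * S i" for i
    unfolding S_def by (rule power_diff_sumr2)
  have S_R: "S i \<in> R" for i unfolding S_def using assms by (intro R_sum R_mult R_power)
  have "S d - of_nat d * x ^ (d - 1) = (\<Sum>j<d. y ^ (d - Suc j) * x ^ j - x ^ (d - 1))"
    by (simp add: S_def sum_subtractf)
  also have "\<dots> \<in> M"
  proof (rule M_sum)
    fix j assume "j \<in> {..<d}"
    hence "x ^ (d - 1) = x ^ (d - Suc j) * x ^ j" by (simp flip: power_add)
    moreover have "y ^ (d - Suc j) * x ^ j \<approx> x ^ (d - Suc j) * x ^ j"
      using assms by (intro cong_mult cong_power R_power cong_sym[OF assms(3)] cong_refl)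
    ultimately show "y ^ (d - Suc j) * x ^ j - x ^ (d - 1) \<in> M" by (simp add: cong_M_def)
  qed
  finally have "S d \<approx> of_nat d * x ^ (d - 1)" by (simp add: cong_M_def)
  moreover have "of_nat d * x ^ (d - 1) \<in> M" using assms by (intro M_mult' d_M R_power)
  ultimately have Sd: "S d \<in> M" using cong_M_iff by blast
  define e where "e = (\<Sum>i<d. Polynomial.coeff \<phi> i * S i) + S d"
  show thesis
  proof (rule that)
    have "Polynomial.coeff \<phi> i * S i \<in> M" if "i < d" for i
    proof (cases "i = 0")
      case False
      thus ?thesis using that by (intro M_mult' coeff_middle S_R) auto
    qed (simp add: S_def M_zero)
    thus "e \<in> M" unfolding e_def using Sd by (intro M_add M_sum) auto
    have "poly \<phi> x - poly \<phi> y = (\<Sum>i<d. Polynomial.coeff \<phi> i * (x ^ i - y ^ i)) + (x ^ d - y ^ d)"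
      by (simp add: poly_eq right_diff_distrib sum_subtractf)
    also have "\<dots> = (x - y) * e"
      unfolding S e_def by (simp add: distrib_left sum_distrib_left mult_ac)
    finally show "poly \<phi> x - poly \<phi> y = (x - y) * e" .
  qed
qed

lemma iterate_contracting:
  assumes "x \<in> R" "y \<in> R" "x \<approx> y" "n > 0"
  shows "\<exists>e\<in>M. (poly \<phi> ^^ n) x - (poly \<phi> ^^ n) y = (x - y) * e"
  using assms(4)
proof (induction n rule: nat_induct_non_zero)
  case 1
  show ?case using poly_contracting[OF assms(1-3)] by auto
next
  case (Suc n)
  let ?x = "(poly \<phi> ^^ n) x" and ?y = "(poly \<phi> ^^ n) y"
  obtain e where e: "e \<in> M" "?x - ?y = (x - y) * e" using Suc.IH by blast
  have "?x \<approx> ?y"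
    unfolding cong_M_def e(2) using assms(1,2) e(1) by (intro M_mult R_diff)
  then obtain e' where "e' \<in> M" "poly \<phi> ?x - poly \<phi> ?y = (?x - ?y) * e'"
    using poly_contracting[OF iterate_R[OF assms(1)] iterate_R[OF assms(2)]] by blast
  thus ?case using e M_mult[OF M_R] by (intro bexI[of _ "e * e'"]) (auto simp: mult.assoc)
qed

text \<open>
  Periodic points are distinguished by their residue classes: iterating along a common period gives
  \<open>x - y = (x - y) * e\<close> with \<open>e \<in> M\<close>, and \<open>e \<noteq> 1\<close>.
\<close>
lemma periodic_eq_if_cong:
  assumes "x \<in> R" "y \<in> R" "x \<approx> y" "n > 0" "(poly \<phi> ^^ n) x = x" "(poly \<phi> ^^ n) y = y"
  shows "x = y"
proof (rule ccontr)
  assume "x \<noteq> y"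
  obtain e where "e \<in> M" "x - y = (x - y) * e"
    using iterate_contracting[OF assms(1-4)] assms(5,6) by auto
  hence "1 \<in> M" using \<open>x \<noteq> y\<close> by (simp add: mult_cancel_left2)
  thus False using M_one by simp
qed

text \<open>
  At a point outside \<open>R\<close> the leading term dominates: \<open>w = \<phi>(x) / x ^ d\<close> is a unit, so the pole
  of \<open>\<phi>(x)\<close> is \<open>d\<close> times that of \<open>x\<close>. Hence the orbit of \<open>x\<close> escapes and never returns to \<open>x\<close>.
\<close>
lemma poly_pole:
  assumes "x \<notin> R"
  obtains e where "e \<in> M" "x = poly \<phi> x * e"
proof -
  define y where "y = inverse x"
  have y: "y \<in> M" unfolding y_def using assms by (rule M_inverse)
  have "x \<noteq> 0" using assms M_R[OF M_zero] by auto
  define w where "w = poly \<phi> x * y ^ d"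
  have xy: "x ^ i * y ^ d = y ^ (d - i)" if "i \<le> d" for i
  proof -
    have "y ^ d = y ^ i * y ^ (d - i)" using that by (simp flip: power_add)
    moreover have "x ^ i * y ^ i = 1" using \<open>x \<noteq> 0\<close> by (simp add: y_def flip: power_mult_distrib)
    ultimately show ?thesis by (simp flip: mult.assoc)
  qed
  have "w = (\<Sum>i<d. Polynomial.coeff \<phi> i * (x ^ i * y ^ d)) + x ^ d * y ^ d"
    by (simp add: w_def poly_eq distrib_right sum_distrib_right mult.assoc)
  also have "\<dots> = (\<Sum>i<d. Polynomial.coeff \<phi> i * y ^ (d - i)) + 1"
    by (simp add: xy)
  finally have "w - 1 = (\<Sum>i<d. Polynomial.coeff \<phi> i * y ^ (d - i))" by simp
  also have "\<dots> \<in> M" using y by (intro M_sum M_mult M_power coeff_R) auto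
  finally have w1: "w - 1 \<in> M" .
  have "w \<in> R" using R_add[OF M_R[OF w1] R_one] by simp
  have "w \<notin> M" using cong_M_iff[of w 1] w1 M_one by (simp add: cong_M_def)
  hence "w \<noteq> 0" using M_zero by auto
  show thesis
  proof (rule that)
    show "inverse w * y ^ (d - 1) \<in> M"
      using \<open>w \<in> R\<close> \<open>w \<notin> M\<close> y d_ge_2 by (intro M_mult R_inverse M_power) auto
    have "y ^ (d - 1) = x * y ^ d" using xy[of 1] d_ge_2 by simp
    hence "poly \<phi> x * (inverse w * y ^ (d - 1)) = x * (w * inverse w)"
      by (simp add: w_def)
    thus "x = poly \<phi> x * (inverse w * y ^ (d - 1))" using \<open>w \<noteq> 0\<close> by simp
  qed
qed

lemma iterate_pole:
  assumes "x \<notin> R" "n > 0"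
  shows "(poly \<phi> ^^ n) x \<notin> R \<and> (\<exists>e\<in>M. x = (poly \<phi> ^^ n) x * e)"
  using assms(2)
proof (induction n rule: nat_induct_non_zero)
  case 1
  obtain e where "e \<in> M" "x = poly \<phi> x * e" using poly_pole[OF assms(1)] .
  thus ?case using assms(1) M_mult M_R by auto metis
next
  case (Suc n)
  let ?x = "(poly \<phi> ^^ n) x"
  obtain e where e: "e \<in> M" "x = ?x * e" using Suc.IH by blast
  obtain e' where e': "e' \<in> M" "?x = poly \<phi> ?x * e'" using poly_pole Suc.IH by blast
  have "x = poly \<phi> ?x * (e' * e)" using e e' by (metis mult.assoc)
  moreover have "e' * e \<in> M" using e e' M_mult M_R by blast
  ultimately show ?case using assms(1) M_mult M_R by auto metis
qed

lemma Per_R: assumes "x \<in> Per \<phi>" shows "x \<in> R"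
proof (rule ccontr)
  assume x: "x \<notin> R"
  obtain n where "n > 0" "(poly \<phi> ^^ n) x = x" using assms by (auto simp: Per_def)
  then obtain e where "e \<in> M" "x = x * e" using iterate_pole[OF x, of n] by metis
  moreover have "x \<noteq> 0" using x M_R[OF M_zero] by auto
  ultimately show False using M_one by (simp add: mult_cancel_left2)
qed

text \<open>
  Since \<open>a\<^sub>0\<close> is fixed by \<open>X ^ d\<close> modulo \<open>M\<close>, additivity of Frobenius lets the translations
  accumulate unchanged: the \<open>n\<close>-th iterate is \<open>X ^ d ^ n + n * a\<^sub>0\<close> modulo \<open>M\<close>.
\<close>
lemma iterate_cong:
  assumes "x \<in> R" and a0: "Polynomial.coeff \<phi> 0 ^ d \<approx> Polynomial.coeff \<phi> 0"
  shows "(poly \<phi> ^^ n) x \<approx> x ^ (d ^ n) + of_nat n * Polynomial.coeff \<phi> 0"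
proof (induction n)
  case (Suc n)
  let ?a = "Polynomial.coeff \<phi> 0" and ?x = "(poly \<phi> ^^ n) x"
  have xR: "?x \<in> R" using iterate_R[OF assms(1)] .
  have na: "of_nat n * ?a \<in> R" by (intro R_mult R_of_nat coeff_0)
  have "(poly \<phi> ^^ Suc n) x = poly \<phi> ?x" by simp
  also have "\<dots> \<approx> ?x ^ d + ?a" using xR by (rule poly_cong)
  also have "\<dots> \<approx> (x ^ (d ^ n) + of_nat n * ?a) ^ d + ?a"
    using Suc xR na assms(1) by (intro cong_add cong_power cong_refl R_add R_power)
  also have "\<dots> \<approx> ((x ^ (d ^ n)) ^ d + (of_nat n * ?a) ^ d) + ?a"
    unfolding d by (intro cong_add cong_refl frobenius_add_iterate R_power na assms(1))
  also have "\<dots> \<approx> ((x ^ (d ^ n)) ^ d + of_nat n * ?a) + ?a"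
    unfolding power_mult_distrib
    using a0 of_nat_frobenius[of n k] coeff_0 R_of_nat
    by (intro cong_add cong_refl cong_mult R_power) (auto simp: d)
  also have "\<dots> = x ^ (d ^ Suc n) + of_nat (Suc n) * ?a"
    by (simp add: power_mult[symmetric] algebra_simps)
  finally show ?case .
qed simp

text \<open>
  The hypotheses on \<open>m\<close> make the \<open>m\<close>-th iterate the identity on residue classes. It maps the
  periodic point \<open>x\<close> to a periodic point of the same class, which can only be \<open>x\<close>.
\<close>
theorem periodic_period:
  assumes x: "x \<in> Per \<phi>" and a0: "Polynomial.coeff \<phi> 0 ^ d \<approx> Polynomial.coeff \<phi> 0"
    and m: "Polynomial.coeff \<phi> 0 * of_nat m \<in> M"
    and fermat: "\<And>x. x \<in> R \<Longrightarrow> x ^ (p ^ (k * m)) \<approx> x"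
  shows "(poly \<phi> ^^ m) x = x"
proof -
  have xR: "x \<in> R" using x by (rule Per_R)
  obtain n where n: "n > 0" "(poly \<phi> ^^ n) x = x" using x by (auto simp: Per_def)
  have "(poly \<phi> ^^ m) x \<approx> x ^ (d ^ m) + of_nat m * Polynomial.coeff \<phi> 0"
    using xR a0 by (rule iterate_cong)
  also have "\<dots> \<approx> x + 0"
    using fermat[OF xR] m by (intro cong_add) (auto simp: d power_mult cong_M_def mult.commute)
  finally have "(poly \<phi> ^^ m) x \<approx> x" by simp
  moreover have "(poly \<phi> ^^ n) ((poly \<phi> ^^ m) x) = (poly \<phi> ^^ m) x"
    using n(2) by (metis comp_apply funpow_add add.commute)
  ultimately show ?thesis
    using periodic_eq_if_cong[OF iterate_R[OF xR] xR _ n(1)] n(2) by blast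
qed

end

section \<open>Periods over number fields\<close>

context number_field_prime
begin

sublocale valring: residue_char_valuation_ring loc loc_max p
proof
  show "0 \<in> loc_max" by (rule loc_max_P[OF P_zero])
  show "loc_max \<subseteq> loc" using loc_max_loc by blast
qed (auto intro: loc_add loc_mult loc_minus loc_max_add loc_max_mult loc_inverse
       inverse_in_loc_max loc_algebraic_int loc_max_P prime_p p_in_P one_notin_loc_max
     simp: one_notin_loc_max)

lemma loc_fermat:
  assumes "x \<in> loc" "residue_degree P dvd n"
  shows "valring.cong_M (x ^ (p ^ n)) x"
proof -
  let ?q = "p ^ residue_degree P"
  obtain y where y: "algebraic_int y" "valring.cong_M x y"
    using loc_residue[OF assms(1)] unfolding valring.cong_M_def by blast
  have "valring.cong_M (x ^ ?q) (y ^ ?q)"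
    using y(2) assms(1) loc_algebraic_int[OF y(1)] by (rule valring.cong_power)
  also have "valring.cong_M (y ^ ?q) y"
    unfolding valring.cong_M_def using P_fermat[OF y(1)] by (rule loc_max_P)
  also have "valring.cong_M y x" using y(2) by (rule valring.cong_sym)
  finally have *: "valring.cong_M (x ^ ?q) x" .
  obtain c where "n = residue_degree P * c" using assms(2) by (elim dvdE)
  thus ?thesis using valring.power_iterate_fixed[OF * assms(1), of c] by (simp add: power_mult)
qed

lemma of_int_in_loc_max_iff: "of_int n \<in> loc_max \<longleftrightarrow> int p dvd n"
  using loc_max_algebraic_int_iff[of "of_int n"] of_int_in_P_iff[of n] by simp

text \<open>
  A rational number that is integral at \<open>P\<close> has its residue in the prime field. For a fraction in
  lowest terms the denominator is prime to \<open>p\<close>, and numerator and denominator are fixed by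
  Frobenius modulo \<open>P\<close>.
\<close>
lemma rational_frobenius:
  assumes "x \<in> loc" "x \<in> \<rat>"
  shows "valring.cong_M (x ^ (p ^ k)) x"
proof -
  obtain r s where rs: "s > 0" "coprime r s" "x = of_int r / of_int s"
    using assms(2) by (rule Rats_cases')
  have xs: "x * of_int s = of_int r" using rs(1,3) by simp
  have "of_int s \<notin> loc_max"
  proof
    assume s: "of_int s \<in> loc_max"
    hence "of_int r \<in> loc_max" using loc_max_mult[OF assms(1) s] xs by simp
    hence "is_unit (int p)"
      using coprime_common_divisor[OF rs(2), of "int p"] s by (simp add: of_int_in_loc_max_iff)
    thus False using prime_p by auto
  qed
  moreover have "valring.cong_M (x ^ (p ^ k) * of_int s) (x * of_int s)"
  proof -
    have "valring.cong_M (x ^ (p ^ k) * of_int s) (x ^ (p ^ k) * of_int s ^ (p ^ k))"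
      using assms(1) by (intro valring.cong_mult valring.cong_refl valring.R_power valring.R_of_int
          valring.cong_sym[OF valring.of_int_frobenius])
    also have "x ^ (p ^ k) * of_int s ^ (p ^ k) = of_int r ^ (p ^ k)"
      using xs by (simp flip: power_mult_distrib)
    also have "valring.cong_M \<dots> (of_int r)" by (rule valring.of_int_frobenius)
    finally show ?thesis using xs by simp
  qed
  ultimately show ?thesis using valring.cong_cancel valring.R_of_int by blast
qed

text \<open>
  The least \<open>m\<close> in the definition exists because \<open>p * f\<close> satisfies the conditions.
\<close>
lemma m_period_properties:
  fixes k :: nat
  assumes "a \<in> loc" "f = residue_degree P"
  defines "m \<equiv> m_period P f a k"
  shows "m > 0 \<and> a * of_nat m \<in> loc_max \<and> f dvd k * m"
proof -
  let ?Q = "\<lambda>m. m > 0 \<and> valuation P (a * of_nat m) \<ge> 1 \<and> f dvd k * m"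
  have "?Q (p * f)"
  proof (intro conjI)
    show "p * f > 0" using prime_p residue_degree_pos assms(2) by (simp add: prime_gt_0_nat)
    have "a * of_nat f * of_nat p \<in> loc_max"
      using assms(1) by (intro loc_max_mult loc_mult loc_max_P[OF p_in_P] valring.R_of_nat)
    thus "valuation P (a * of_nat (p * f)) \<ge> 1" by (intro valuation_ge_1) (simp add: mult_ac)
  qed simp
  hence "?Q m" unfolding m_def m_period_def by (rule LeastI)
  moreover have "valuation P (a * of_nat m) > 0" if "valuation P (a * of_nat m) \<ge> 1"
    using that by (rule less_le_trans[rotated]) (simp add: zero_extended_def one_extended_def)
  ultimately show ?thesis using valuation_pos by blast
qed

end

theorem theorem5:
  fixes P :: "'a::field_char_0 set" and \<phi> :: "'a poly" and p k d f :: nat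
  assumes "number_field TYPE('a)"
    and "Factorial_Ring.prime p" and "k \<ge> 1" and "d = p ^ k"
    and "primeideal P \<O>" and "lies_above P p" and "f = residue_degree P"
    and "Polynomial.degree \<phi> = d" and "Polynomial.coeff \<phi> d = 1"
    and "good_reduction P \<phi>"
    and "\<And>i. i \<le> d \<Longrightarrow> i \<notin> {0, d} \<Longrightarrow> valuation P (Polynomial.coeff \<phi> i) > 0"
    and "f dvd k \<or> Polynomial.coeff \<phi> 0 \<in> \<rat>"
  shows "\<forall>x\<in>Per \<phi>. (poly \<phi> ^^ m_period P f (Polynomial.coeff \<phi> 0) k) x = x"
proof
  fix x assume x: "x \<in> Per \<phi>"
  interpret number_field_prime P p using assms by (intro number_field_prime.intro)
  let ?a = "Polynomial.coeff \<phi> 0"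
  have a0: "?a \<in> loc"
    using assms(10) unfolding good_reduction_def by (intro valuation_nonneg) auto
  interpret frobenius_like_polynomial loc loc_max p \<phi> d k
    using assms a0 by unfold_locales (auto intro: valuation_pos)
  have "valring.cong_M (?a ^ d) ?a"
    unfolding \<open>d = p ^ k\<close> using assms(7,12) a0 loc_fermat rational_frobenius by blast
  moreover note m = m_period_properties[OF a0 \<open>f = residue_degree P\<close>, of k]
  ultimately show "(poly \<phi> ^^ m_period P f ?a k) x = x"
    using x loc_fermat assms(7) by (intro periodic_period) auto
qed

end
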